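(* Let $p$ be an odd prime and let $f=\exp(x^p/p+x)$. Then for $x\in\mathbb{Z}_p$, $$[f](x)=\begin{cases}\Gamma_p(x) & \text{if } |x|<1,\\ 0 & \text{if } |x|=1.\end{cases}$$
   Context: $p$ is an odd prime, $|\cdot|$ is the $p$-adic norm. $(x)_n=x(x-1)\cdots(x-n+1)$ denotes the falling factorial (with $(x)_0=1$). For a power series $g=\sum_{i\ge0} a_i x^i$ with coefficients in $\mathbb{C}_p$ (the completion of the algebraic closure of $\mathbb{Q}_p$), the associated Mahler series is $[g]=\sum_{i\ge 0} a_i(-1)^i (x)_i$; when $|a_i\, i!|\to 0$ it defines a continuous function on $\mathbb{Z}_p$, with value $[g](x)$ at $x$. $\Gamma_p:\mathbb{Z}_p\to\mathbb{Z}_p^\times$ is the (Morita) $p$-adic Gamma function: the unique continuous function with $\Gamma_p(0)=1$, $\Gamma_p(x+1)=-x\Gamma_p(x)$ if $|x|=1$, and $\Gamma_p(x+1)=-\Gamma_p(x)$ if $|x|<1$. *)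

theory Defs
  imports
    "HOL-Algebra.Algebraic_Closure_Type"
    "HOL-Computational_Algebra.Formal_Power_Series"
    "Berlekamp_Zassenhaus.Finite_Field"
  begin

section \<open>Non-Archimedean valued fields\<close>

text \<open>
  The library constant \<open>norm\<close> is reserved for real normed vector spaces, so the
  absolute value of a valued field is a separate constant \<open>vabs\<close>; it
  induces the library's \<open>dist\<close> and hence the library's topology.
\<close>

class valued_field = field_char_0 + metric_space +
  fixes vabs :: "'a \<Rightarrow> real"
  assumes dist_vabs: "dist x y = vabs (x - y)"
    and vabs_mult: "vabs (x * y) = vabs x * vabs y"
    and vabs_ultra: "vabs (x + y) \<le> max (vabs x) (vabs y)"
begin

lemma vabs_nonneg [simp]: "0 \<le> vabs x"
  using dist_vabs[of x 0] zero_le_dist[of x 0] by simp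

lemma vabs_eq_0_iff [simp]: "vabs x = 0 \<longleftrightarrow> x = 0"
  using dist_vabs[of x 0] dist_eq_0_iff[of x 0] by simp

lemma vabs_0 [simp]: "vabs 0 = 0"
  by simp

lemma vabs_1 [simp]: "vabs 1 = 1"
  using vabs_mult[of 1 1] vabs_eq_0_iff[of 1] by auto

lemma vabs_minus_commute: "vabs (x - y) = vabs (y - x)"
  using dist_vabs[of x y] dist_vabs[of y x] dist_commute[of x y] by simp

lemma vabs_minus [simp]: "vabs (- x) = vabs x"
  using vabs_minus_commute[of 0 x] by simp

lemma vabs_pos_iff [simp]: "0 < vabs x \<longleftrightarrow> x \<noteq> 0"
  using vabs_nonneg[of x] vabs_eq_0_iff[of x] by linarith

lemma vabs_ultra_diff: "vabs (x - y) \<le> max (vabs x) (vabs y)"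
  using vabs_ultra[of x "- y"] by simp

lemma vabs_inverse: "vabs (inverse x) = inverse (vabs x)"
proof (cases "x = 0")
  case False
  then have "vabs x * vabs (inverse x) = 1"
    using vabs_mult[of x "inverse x"] by simp
  then show ?thesis
    using False by (simp add: field_simps)
qed simp

lemma vabs_divide: "vabs (x / y) = vabs x / vabs y"
  by (simp add: field_divide_inverse vabs_mult vabs_inverse Fields.field_class.field_divide_inverse)

lemma vabs_power: "vabs (x ^ n) = vabs x ^ n"
  by (induction n) (simp_all add: vabs_mult)

lemma vabs_eqI: "vabs (x - y) < vabs y \<Longrightarrow> vabs x = vabs y"
  using vabs_ultra[of "x - y" y] vabs_ultra[of "y - x" x] vabs_minus_commute[of x y]
  by (auto simp: max_def split: if_splits)

lemma abs_vabs_diff_le: "\<bar>vabs x - vabs y\<bar> \<le> vabs (x - y)"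
proof -
  have "vabs x \<le> max (vabs (x - y)) (vabs y)" "vabs y \<le> max (vabs (x - y)) (vabs x)"
    using vabs_ultra[of "x - y" y] vabs_ultra[of "y - x" x] vabs_minus_commute[of x y] by simp_all
  then show ?thesis
    using vabs_nonneg[of x] vabs_nonneg[of y] vabs_nonneg[of "x - y"] by linarith
qed

end

lemma tendsto_vabs_iff:
  fixes l :: "'a :: valued_field"
  shows "(f \<longlongrightarrow> l) F \<longleftrightarrow> ((\<lambda>x. vabs (f x - l)) \<longlongrightarrow> 0) F"
  by (subst tendsto_dist_iff) (simp add: dist_vabs)

lemma tendsto_0_sandwich:
  fixes f g :: "'b \<Rightarrow> real"
  assumes "\<forall>\<^sub>F x in F. norm (f x) \<le> g x" and "(g \<longlongrightarrow> 0) F"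
  shows "(f \<longlongrightarrow> 0) F"
  by (rule tendsto_norm_zero_cancel, rule tendsto_sandwich[OF _ assms(1) tendsto_const assms(2)]) simp

lemma tendsto_fst_nhds_prod: "(fst \<longlongrightarrow> a) (nhds a \<times>\<^sub>F nhds b)"
  and tendsto_snd_nhds_prod: "(snd \<longlongrightarrow> b) (nhds a \<times>\<^sub>F nhds b)"
  by (simp_all add: filterlim_def filtermap_fst_prod_filter filtermap_snd_prod_filter)

lemma tendsto_vabs:
  fixes l :: "'a :: valued_field"
  assumes "(f \<longlongrightarrow> l) F"
  shows "((\<lambda>x. vabs (f x)) \<longlongrightarrow> vabs l) F"
proof -
  have "((\<lambda>x. vabs (f x) - vabs l) \<longlongrightarrow> 0) F"
    by (rule tendsto_0_sandwich[OF _ assms[unfolded tendsto_vabs_iff]])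
      (simp add: abs_vabs_diff_le)
  then show ?thesis
    by (rule LIM_zero_cancel)
qed

lemma Cauchy_vabs_iff:
  fixes s :: "nat \<Rightarrow> 'a :: valued_field"
  shows "Cauchy s \<longleftrightarrow> (\<forall>e>0. \<exists>M. \<forall>m\<ge>M. \<forall>n\<ge>M. vabs (s m - s n) < e)"
  by (simp add: Cauchy_def dist_vabs)

instance valued_field \<subseteq> topological_ab_group_add
proof
  fix a b :: 'a
  have 1: "((\<lambda>x. vabs (fst x - a)) \<longlongrightarrow> 0) (nhds a \<times>\<^sub>F nhds b)"
    by (subst tendsto_vabs_iff[symmetric]) (rule tendsto_fst_nhds_prod)
  have 2: "((\<lambda>x. vabs (snd x - b)) \<longlongrightarrow> 0) (nhds a \<times>\<^sub>F nhds b)"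
    by (subst tendsto_vabs_iff[symmetric]) (rule tendsto_snd_nhds_prod)
  show "((\<lambda>x. fst x + snd x) \<longlongrightarrow> a + b) (nhds a \<times>\<^sub>F nhds b)"
  proof (subst tendsto_vabs_iff, rule tendsto_0_sandwich)
    show "((\<lambda>x. vabs (fst x - a) + vabs (snd x - b)) \<longlongrightarrow> 0) (nhds a \<times>\<^sub>F nhds b)"
      using tendsto_add[OF 1 2] by simp
    show "\<forall>\<^sub>F x in nhds a \<times>\<^sub>F nhds b.
        norm (vabs (fst x + snd x - (a + b))) \<le> vabs (fst x - a) + vabs (snd x - b)"
    proof (rule always_eventually, rule allI)
      fix x :: "'a \<times> 'a"
      have "vabs ((fst x - a) + (snd x - b)) \<le> vabs (fst x - a) + vabs (snd x - b)"
        using vabs_ultra[of "fst x - a" "snd x - b"]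
          vabs_nonneg[of "fst x - a"] vabs_nonneg[of "snd x - b"] by linarith
      then show "norm (vabs (fst x + snd x - (a + b))) \<le> vabs (fst x - a) + vabs (snd x - b)"
        by (simp add: algebra_simps)
    qed
  qed
next
  fix a :: 'a
  show "(uminus \<longlongrightarrow> - a) (nhds a)"
  proof (subst tendsto_vabs_iff)
    have "((\<lambda>x. vabs (x - a)) \<longlongrightarrow> 0) (nhds a)"
      by (subst tendsto_vabs_iff[symmetric]) (rule filterlim_ident)
    moreover have "vabs (- x - - a) = vabs (x - a)" for x
      using vabs_minus[of "x - a"] by (simp add: algebra_simps)
    ultimately show "((\<lambda>x. vabs (- x - - a)) \<longlongrightarrow> 0) (nhds a)"
      by simp
  qed
qed

instance valued_field \<subseteq> topological_semigroup_mult
proof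
  fix a b :: 'a
  let ?F = "nhds a \<times>\<^sub>F nhds b"
  have 0: "(fst \<longlongrightarrow> a) ?F" "(snd \<longlongrightarrow> b) ?F"
    by (rule tendsto_fst_nhds_prod, rule tendsto_snd_nhds_prod)
  have 1: "((\<lambda>x. vabs (fst x - a)) \<longlongrightarrow> 0) ?F" "((\<lambda>x. vabs (snd x - b)) \<longlongrightarrow> 0) ?F"
    using 0 by (simp_all add: tendsto_vabs_iff[symmetric])
  show "((\<lambda>x. fst x * snd x) \<longlongrightarrow> a * b) ?F"
  proof (subst tendsto_vabs_iff, rule tendsto_0_sandwich)
    have "((\<lambda>x. vabs (fst x - a) * vabs (snd x) + vabs a * vabs (snd x - b))
        \<longlongrightarrow> 0 * vabs b + vabs a * 0) ?F"
      by (intro tendsto_add tendsto_mult 1 tendsto_const tendsto_vabs 0)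
    then show "((\<lambda>x. vabs (fst x - a) * vabs (snd x) + vabs a * vabs (snd x - b)) \<longlongrightarrow> 0) ?F"
      by simp
    show "\<forall>\<^sub>F x in ?F. norm (vabs (fst x * snd x - a * b))
        \<le> vabs (fst x - a) * vabs (snd x) + vabs a * vabs (snd x - b)"
    proof (rule always_eventually, rule allI)
      fix x :: "'a \<times> 'a"
      have "vabs ((fst x - a) * snd x + a * (snd x - b))
          \<le> vabs ((fst x - a) * snd x) + vabs (a * (snd x - b))"
        using vabs_ultra[of "(fst x - a) * snd x" "a * (snd x - b)"]
          vabs_nonneg[of "(fst x - a) * snd x"] vabs_nonneg[of "a * (snd x - b)"] by linarith
      also have "(fst x - a) * snd x + a * (snd x - b) = fst x * snd x - a * b"
        by (simp add: algebra_simps)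
      finally show "norm (vabs (fst x * snd x - a * b))
          \<le> vabs (fst x - a) * vabs (snd x) + vabs a * vabs (snd x - b)"
        by (simp add: vabs_mult)
    qed
  qed
qed

lemma tendsto_vabs_inverse:
  fixes l :: "'a :: valued_field"
  assumes lim: "(f \<longlongrightarrow> l) F" and "l \<noteq> 0"
  shows "((\<lambda>x. inverse (f x)) \<longlongrightarrow> inverse l) F"
proof (subst tendsto_vabs_iff)
  have ev: "\<forall>\<^sub>F x in F. f x \<noteq> 0"
    using tendsto_imp_eventually_ne[OF assms] .
  have "((\<lambda>x. inverse (vabs (f x)) * vabs (f x - l) * inverse (vabs l))
      \<longlongrightarrow> inverse (vabs l) * 0 * inverse (vabs l)) F"
    using assms lim[unfolded tendsto_vabs_iff]
    by (intro tendsto_mult tendsto_inverse tendsto_const tendsto_vabs) auto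
  then have "((\<lambda>x. inverse (vabs (f x)) * vabs (f x - l) * inverse (vabs l)) \<longlongrightarrow> 0) F"
    by simp
  then show "((\<lambda>x. vabs (inverse (f x) - inverse l)) \<longlongrightarrow> 0) F"
  proof (rule Lim_transform_eventually)
    show "\<forall>\<^sub>F x in F. inverse (vabs (f x)) * vabs (f x - l) * inverse (vabs l)
        = vabs (inverse (f x) - inverse l)"
      using ev
    proof eventually_elim
      case (elim x)
      have "inverse (f x) - inverse l = - (inverse (f x) * (f x - l) * inverse l)"
        using elim \<open>l \<noteq> 0\<close> by (simp add: field_simps)
      then show ?case
        by (metis vabs_minus vabs_mult vabs_inverse)
    qed
  qed
qed


section \<open>The completion of a valued field\<close>

lemma Cauchy_vabs_convergent:
  fixes s :: "nat \<Rightarrow> 'a :: valued_field"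
  assumes "Cauchy s"
  shows "convergent (\<lambda>n. vabs (s n))"
proof (rule real_Cauchy_convergent, rule metric_CauchyI)
  fix e :: real
  assume "0 < e"
  then obtain M where "\<forall>m\<ge>M. \<forall>n\<ge>M. vabs (s m - s n) < e"
    using assms unfolding Cauchy_vabs_iff by blast
  then show "\<exists>M. \<forall>m\<ge>M. \<forall>n\<ge>M. dist (vabs (s m)) (vabs (s n)) < e"
    unfolding dist_real_def using abs_vabs_diff_le le_less_trans by blast
qed

lemma Cauchy_vabs_tendsto:
  fixes s :: "nat \<Rightarrow> 'a :: valued_field"
  assumes "Cauchy s"
  shows "(\<lambda>n. vabs (s n)) \<longlonglongrightarrow> lim (\<lambda>n. vabs (s n))"
  using Cauchy_vabs_convergent[OF assms] by (simp add: convergent_LIMSEQ_iff)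

lemma Cauchy_vabs_bounded:
  fixes s :: "nat \<Rightarrow> 'a :: valued_field"
  assumes "Cauchy s"
  obtains B where "B > 0" "\<And>n. vabs (s n) \<le> B"
proof -
  have "Bseq (\<lambda>n. vabs (s n))"
    using Cauchy_vabs_convergent[OF assms] by (rule convergent_imp_Bseq)
  then show ?thesis
    by (rule BseqE) (use that in auto)
qed

lemma Cauchy_vadd:
  fixes s t :: "nat \<Rightarrow> 'a :: valued_field"
  assumes s: "Cauchy s" and t: "Cauchy t"
  shows "Cauchy (\<lambda>n. s n + t n)"
  unfolding Cauchy_vabs_iff
proof (intro allI impI)
  fix e :: real
  assume "0 < e"
  obtain M where M: "\<And>m n. m \<ge> M \<Longrightarrow> n \<ge> M \<Longrightarrow> vabs (s m - s n) < e"
    using s \<open>0 < e\<close> unfolding Cauchy_vabs_iff by blast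
  obtain N where N: "\<And>m n. m \<ge> N \<Longrightarrow> n \<ge> N \<Longrightarrow> vabs (t m - t n) < e"
    using t \<open>0 < e\<close> unfolding Cauchy_vabs_iff by blast
  have "vabs (s m + t m - (s n + t n)) < e" if "m \<ge> max M N" "n \<ge> max M N" for m n
  proof -
    have "vabs ((s m - s n) + (t m - t n)) < e"
      using vabs_ultra[of "s m - s n" "t m - t n"] M[of m n] N[of m n] that by auto
    then show ?thesis
      by (simp add: algebra_simps)
  qed
  then show "\<exists>M. \<forall>m\<ge>M. \<forall>n\<ge>M. vabs (s m + t m - (s n + t n)) < e"
    by blast
qed

lemma Cauchy_vminus:
  fixes s :: "nat \<Rightarrow> 'a :: valued_field"
  assumes "Cauchy s"
  shows "Cauchy (\<lambda>n. - s n)"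
proof -
  have "vabs (- s m - - s n) = vabs (s m - s n)" for m n
    using vabs_minus[of "s m - s n"] by (simp add: algebra_simps)
  then show ?thesis
    using assms by (simp add: Cauchy_vabs_iff)
qed

lemma Cauchy_vdiff:
  fixes s t :: "nat \<Rightarrow> 'a :: valued_field"
  assumes "Cauchy s" and "Cauchy t"
  shows "Cauchy (\<lambda>n. s n - t n)"
  using Cauchy_vadd[OF assms(1) Cauchy_vminus[OF assms(2)]] by simp

lemma Cauchy_vmult:
  fixes s t :: "nat \<Rightarrow> 'a :: valued_field"
  assumes s: "Cauchy s" and t: "Cauchy t"
  shows "Cauchy (\<lambda>n. s n * t n)"
  unfolding Cauchy_vabs_iff
proof (intro allI impI)
  fix e :: real
  assume "0 < e"
  obtain B where B: "B > 0" "\<And>n. vabs (s n) \<le> B"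
    using Cauchy_vabs_bounded[OF s] by blast
  obtain C where C: "C > 0" "\<And>n. vabs (t n) \<le> C"
    using Cauchy_vabs_bounded[OF t] by blast
  obtain M where M: "\<And>m n. m \<ge> M \<Longrightarrow> n \<ge> M \<Longrightarrow> vabs (s m - s n) < e / C"
    using s \<open>0 < e\<close> \<open>C > 0\<close> unfolding Cauchy_vabs_iff by (meson divide_pos_pos)
  obtain N where N: "\<And>m n. m \<ge> N \<Longrightarrow> n \<ge> N \<Longrightarrow> vabs (t m - t n) < e / B"
    using t \<open>0 < e\<close> \<open>B > 0\<close> unfolding Cauchy_vabs_iff by (meson divide_pos_pos)
  have "vabs (s m * t m - s n * t n) < e" if "m \<ge> max M N" "n \<ge> max M N" for m n
  proof -
    have "vabs ((s m - s n) * t m) \<le> vabs (s m - s n) * C"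
      unfolding vabs_mult by (intro mult_left_mono C) simp
    also have "\<dots> < e"
      using M[of m n] that \<open>C > 0\<close> by (simp add: field_simps)
    finally have 1: "vabs ((s m - s n) * t m) < e" .
    have "vabs (s n * (t m - t n)) \<le> B * vabs (t m - t n)"
      unfolding vabs_mult by (intro mult_right_mono B) simp
    also have "\<dots> < e"
      using N[of m n] that \<open>B > 0\<close> by (simp add: field_simps)
    finally have 2: "vabs (s n * (t m - t n)) < e" .
    have "s m * t m - s n * t n = (s m - s n) * t m + s n * (t m - t n)"
      by (simp add: algebra_simps)
    then show ?thesis
      using vabs_ultra[of "(s m - s n) * t m" "s n * (t m - t n)"] 1 2 by simp
  qed
  then show "\<exists>M. \<forall>m\<ge>M. \<forall>n\<ge>M. vabs (s m * t m - s n * t n) < e"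
    by blast
qed

lemma Cauchy_nonnull_lower_bound:
  fixes s :: "nat \<Rightarrow> 'a :: valued_field"
  assumes s: "Cauchy s" and nz: "\<not> s \<longlonglongrightarrow> 0"
  obtains d M where "d > 0" "\<And>n. n \<ge> M \<Longrightarrow> vabs (s n) > d"
proof -
  let ?L = "lim (\<lambda>n. vabs (s n))"
  have L: "(\<lambda>n. vabs (s n)) \<longlonglongrightarrow> ?L"
    using Cauchy_vabs_tendsto[OF s] .
  have "?L \<ge> 0"
    by (rule LIMSEQ_le_const[OF L]) simp
  moreover have "?L \<noteq> 0"
    using L nz by (auto simp: tendsto_vabs_iff[of s])
  ultimately have "?L > 0"
    by simp
  then have "\<forall>\<^sub>F n in sequentially. vabs (s n) > ?L / 2"
    by (intro order_tendstoD(1)[OF L]) simp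
  then show ?thesis
    using \<open>?L > 0\<close> that[of "?L / 2"] unfolding eventually_sequentially
    by (metis half_gt_zero)
qed

lemma Cauchy_vinverse:
  fixes s :: "nat \<Rightarrow> 'a :: valued_field"
  assumes s: "Cauchy s" and nz: "\<not> s \<longlonglongrightarrow> 0"
  shows "Cauchy (\<lambda>n. inverse (s n))"
  unfolding Cauchy_vabs_iff
proof (intro allI impI)
  fix e :: real
  assume "0 < e"
  obtain d K where d: "d > 0" "\<And>n. n \<ge> K \<Longrightarrow> vabs (s n) > d"
    using Cauchy_nonnull_lower_bound[OF s nz] by blast
  obtain M where M: "\<And>m n. m \<ge> M \<Longrightarrow> n \<ge> M \<Longrightarrow> vabs (s m - s n) < e * (d * d)"
    using s \<open>0 < e\<close> \<open>d > 0\<close> unfolding Cauchy_vabs_iff by (meson mult_pos_pos)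
  have "vabs (inverse (s m) - inverse (s n)) < e" if "m \<ge> max K M" "n \<ge> max K M" for m n
  proof -
    have dm: "vabs (s m) > d" and dn: "vabs (s n) > d"
      using d(2) that by auto
    then have nz: "s m \<noteq> 0" "s n \<noteq> 0"
      using \<open>d > 0\<close> by (auto simp flip: vabs_pos_iff)
    have "inverse (s m) - inverse (s n) = (s n - s m) * inverse (s m * s n)"
      using nz by (simp add: field_simps)
    then have eq: "vabs (inverse (s m) - inverse (s n)) * (vabs (s m) * vabs (s n)) = vabs (s n - s m)"
      using nz by (simp add: vabs_mult vabs_divide field_simps)
    have "vabs (s n - s m) < e * (d * d)"
      using M[of n m] that by simp
    also have "\<dots> \<le> e * (vabs (s m) * vabs (s n))"
      using \<open>0 < e\<close> \<open>d > 0\<close> dm dn by (intro mult_left_mono mult_mono) auto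
    finally show ?thesis
      unfolding eq[symmetric] using nz by (simp add: mult_less_cancel_right)
  qed
  then show "\<exists>M. \<forall>m\<ge>M. \<forall>n\<ge>M. vabs (inverse (s m) - inverse (s n)) < e"
    by blast
qed

lemma Cauchy_mult_null:
  fixes s t :: "nat \<Rightarrow> 'a :: valued_field"
  assumes s: "Cauchy s" and t: "t \<longlonglongrightarrow> 0"
  shows "(\<lambda>n. s n * t n) \<longlonglongrightarrow> 0"
  using tendsto_mult[OF Cauchy_vabs_tendsto[OF s] tendsto_vabs[OF t]]
  by (simp add: tendsto_vabs_iff[of "\<lambda>n. s n * t n"] vabs_mult)

definition cauchy_rel :: "(nat \<Rightarrow> 'a :: valued_field) \<Rightarrow> (nat \<Rightarrow> 'a) \<Rightarrow> bool" where
  "cauchy_rel s t \<longleftrightarrow> Cauchy s \<and> Cauchy t \<and> (\<lambda>n. s n - t n) \<longlonglongrightarrow> 0"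

lemma cauchy_rel_refl_iff [simp]: "cauchy_rel s s \<longleftrightarrow> Cauchy s"
  by (simp add: cauchy_rel_def)

lemma cauchy_rel_sym: "cauchy_rel s t \<Longrightarrow> cauchy_rel t s"
  unfolding cauchy_rel_def using tendsto_minus[of "\<lambda>n. s n - t n" 0 sequentially] by simp

lemma cauchy_rel_eqI: "Cauchy s \<Longrightarrow> (\<And>n. s n = t n) \<Longrightarrow> cauchy_rel s t"
  by (subgoal_tac "s = t") auto

lemma Cauchy_const_vf [simp]: "Cauchy (\<lambda>_. c :: 'a :: valued_field)"
  by (simp add: Cauchy_vabs_iff)

quotient_type (overloaded) 'a vcompletion = "nat \<Rightarrow> 'a :: valued_field" / partial: cauchy_rel
  morphisms rep_vcompletion abs_vcompletion
proof (rule part_equivpI)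
  show "\<exists>s :: nat \<Rightarrow> 'a. cauchy_rel s s"
    by (rule exI[of _ "\<lambda>_. 0"]) simp
  show "symp (cauchy_rel :: (nat \<Rightarrow> 'a) \<Rightarrow> _)"
    by (rule sympI) (rule cauchy_rel_sym)
  show "transp (cauchy_rel :: (nat \<Rightarrow> 'a) \<Rightarrow> _)"
  proof (rule transpI)
    fix s t u :: "nat \<Rightarrow> 'a"
    assume *: "cauchy_rel s t" "cauchy_rel t u"
    then have "(\<lambda>n. (s n - t n) + (t n - u n)) \<longlonglongrightarrow> 0 + 0"
      unfolding cauchy_rel_def by (intro tendsto_add) auto
    then show "cauchy_rel s u"
      using * by (simp add: cauchy_rel_def)
  qed
qed

lemma cauchy_rel_nullD:
  assumes "cauchy_rel s t" "s \<longlonglongrightarrow> 0"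
  shows "t \<longlonglongrightarrow> 0"
proof -
  have "(\<lambda>n. s n - (s n - t n)) \<longlonglongrightarrow> 0 - 0"
    using assms unfolding cauchy_rel_def by (intro tendsto_diff) auto
  then show ?thesis
    by simp
qed

lemma cauchy_rel_null_iff: "cauchy_rel s t \<Longrightarrow> s \<longlonglongrightarrow> 0 \<longleftrightarrow> t \<longlonglongrightarrow> 0"
proof -
  assume st: "cauchy_rel s t"
  moreover from st have "cauchy_rel t s"
    by (rule cauchy_rel_sym)
  ultimately show ?thesis
    using cauchy_rel_nullD by blast
qed

instantiation vcompletion :: (valued_field) field
begin

lift_definition zero_vcompletion :: "'a vcompletion" is "\<lambda>_. 0"
  by simp

lift_definition one_vcompletion :: "'a vcompletion" is "\<lambda>_. 1"
  by simp

lift_definition plus_vcompletion :: "'a vcompletion \<Rightarrow> 'a vcompletion \<Rightarrow> 'a vcompletion"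
  is "\<lambda>s t n. s n + t n"
proof -
  fix s s' t t' :: "nat \<Rightarrow> 'a"
  assume "cauchy_rel s s'" "cauchy_rel t t'"
  then show "cauchy_rel (\<lambda>n. s n + t n) (\<lambda>n. s' n + t' n)"
    unfolding cauchy_rel_def
    using tendsto_add[of "\<lambda>n. s n - s' n" 0 sequentially "\<lambda>n. t n - t' n" 0]
    by (auto intro: Cauchy_vadd simp: algebra_simps)
qed

lift_definition uminus_vcompletion :: "'a vcompletion \<Rightarrow> 'a vcompletion"
  is "\<lambda>s n. - s n"
proof -
  fix s s' :: "nat \<Rightarrow> 'a"
  assume "cauchy_rel s s'"
  then show "cauchy_rel (\<lambda>n. - s n) (\<lambda>n. - s' n)"
    unfolding cauchy_rel_def
    using tendsto_minus[of "\<lambda>n. s n - s' n" 0 sequentially]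
    by (auto intro: Cauchy_vminus)
qed

lift_definition times_vcompletion :: "'a vcompletion \<Rightarrow> 'a vcompletion \<Rightarrow> 'a vcompletion"
  is "\<lambda>s t n. s n * t n"
proof -
  fix s s' t t' :: "nat \<Rightarrow> 'a"
  assume *: "cauchy_rel s s'" "cauchy_rel t t'"
  then have "(\<lambda>n. t n * (s n - s' n) + s' n * (t n - t' n)) \<longlonglongrightarrow> 0 + 0"
    unfolding cauchy_rel_def by (intro tendsto_add Cauchy_mult_null) auto
  with * show "cauchy_rel (\<lambda>n. s n * t n) (\<lambda>n. s' n * t' n)"
    unfolding cauchy_rel_def by (auto intro: Cauchy_vmult simp: algebra_simps)
qed

lift_definition inverse_vcompletion :: "'a vcompletion \<Rightarrow> 'a vcompletion"
  is "\<lambda>s. if s \<longlonglongrightarrow> 0 then \<lambda>_. 0 else (\<lambda>n. inverse (s n))"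
proof -
  fix s t :: "nat \<Rightarrow> 'a"
  assume st: "cauchy_rel s t"
  show "cauchy_rel (if s \<longlonglongrightarrow> 0 then \<lambda>_. 0 else (\<lambda>n. inverse (s n)))
     (if t \<longlonglongrightarrow> 0 then \<lambda>_. 0 else (\<lambda>n. inverse (t n)))"
  proof (cases "s \<longlonglongrightarrow> 0")
    case True
    then show ?thesis
      using cauchy_rel_null_iff[OF st] by simp
  next
    case False
    then have nz: "\<not> s \<longlonglongrightarrow> 0" "\<not> t \<longlonglongrightarrow> 0"
      using cauchy_rel_null_iff[OF st] by auto
    have C: "Cauchy s" "Cauchy t" "(\<lambda>n. s n - t n) \<longlonglongrightarrow> 0"
      using st by (auto simp: cauchy_rel_def)
    obtain d M where d: "d > 0" "\<And>n. n \<ge> M \<Longrightarrow> vabs (s n) > d"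
      using Cauchy_nonnull_lower_bound[OF C(1) nz(1)] by blast
    obtain d' M' where d': "d' > 0" "\<And>n. n \<ge> M' \<Longrightarrow> vabs (t n) > d'"
      using Cauchy_nonnull_lower_bound[OF C(2) nz(2)] by blast
    have "(\<lambda>n. - (inverse (s n) * inverse (t n)) * (s n - t n)) \<longlonglongrightarrow> 0"
      by (intro Cauchy_mult_null Cauchy_vminus Cauchy_vmult Cauchy_vinverse C nz)
    then have "(\<lambda>n. inverse (s n) - inverse (t n)) \<longlonglongrightarrow> 0"
    proof (rule Lim_transform_eventually)
      show "\<forall>\<^sub>F n in sequentially. - (inverse (s n) * inverse (t n)) * (s n - t n)
          = inverse (s n) - inverse (t n)"
      proof (rule eventually_sequentiallyI[of "max M M'"])
        fix n assume "n \<ge> max M M'"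
        then have "vabs (s n) > 0" "vabs (t n) > 0"
          using d d' by (meson less_trans max.boundedE)+
        then show "- (inverse (s n) * inverse (t n)) * (s n - t n) = inverse (s n) - inverse (t n)"
          by (simp add: field_simps)
      qed
    qed
    then show ?thesis
      using nz C by (simp add: cauchy_rel_def Cauchy_vinverse)
  qed
qed

definition "x - y = x + - y" for x y :: "'a vcompletion"

definition "x div y = x * inverse y" for x y :: "'a vcompletion"

instance
proof
  fix a b c :: "'a vcompletion"
  show "a + b + c = a + (b + c)"
    by transfer (rule cauchy_rel_eqI, simp_all add: Cauchy_vadd add.assoc)
  show "a + b = b + a"
    by transfer (rule cauchy_rel_eqI, simp_all add: Cauchy_vadd add.commute)
  show "0 + a = a"
    by transfer simp
  show "- a + a = 0"
    by transfer simp
  show "a - b = a + - b"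
    by (rule minus_vcompletion_def)
  show "a * b * c = a * (b * c)"
    by transfer (rule cauchy_rel_eqI, simp_all add: Cauchy_vmult mult.assoc)
  show "a * b = b * a"
    by transfer (rule cauchy_rel_eqI, simp_all add: Cauchy_vmult mult.commute)
  show "1 * a = a"
    by transfer simp
  show "(a + b) * c = a * c + b * c"
    by transfer (rule cauchy_rel_eqI, simp_all add: Cauchy_vmult Cauchy_vadd distrib_right)
  show "0 \<noteq> (1 :: 'a vcompletion)"
  proof transfer
    show "\<not> cauchy_rel (\<lambda>_. 0) (\<lambda>_. 1 :: 'a)"
      by (auto simp: cauchy_rel_def LIMSEQ_const_iff)
  qed
  show "a div b = a * inverse b"
    by (rule divide_vcompletion_def)
  show "inverse (0 :: 'a vcompletion) = 0"
    by transfer simp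
  show "inverse a * a = 1" if "a \<noteq> 0"
    using that
  proof transfer
    fix s :: "nat \<Rightarrow> 'a"
    assume "cauchy_rel s s" "\<not> cauchy_rel s (\<lambda>_. 0)"
    then have s: "Cauchy s" "\<not> s \<longlonglongrightarrow> 0"
      by (auto simp: cauchy_rel_def)
    obtain d M where d: "d > 0" "\<And>n. n \<ge> M \<Longrightarrow> vabs (s n) > d"
      using Cauchy_nonnull_lower_bound[OF s] by blast
    have "\<forall>\<^sub>F n in sequentially. 0 = inverse (s n) * s n - 1"
    proof (rule eventually_sequentiallyI[of M])
      fix n assume "n \<ge> M"
      then have "vabs (s n) > 0"
        using d by (meson less_trans)
      then show "0 = inverse (s n) * s n - 1"
        by simp
    qed
    then have "(\<lambda>n. inverse (s n) * s n - 1) \<longlonglongrightarrow> 0"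
      using tendsto_const by (rule Lim_transform_eventually[rotated])
    then show "cauchy_rel (\<lambda>n. (if s \<longlonglongrightarrow> 0 then \<lambda>_. 0 else (\<lambda>n. inverse (s n))) n * s n) (\<lambda>_. 1)"
      using s by (auto simp: cauchy_rel_def intro!: Cauchy_vmult Cauchy_vinverse)
  qed
qed

end

lift_definition to_vcompletion :: "'a :: valued_field \<Rightarrow> 'a vcompletion" is "\<lambda>c _. c"
  by simp

lemma to_vcompletion_add: "to_vcompletion (x + y) = to_vcompletion x + to_vcompletion y"
  by transfer simp

lemma to_vcompletion_mult: "to_vcompletion (x * y) = to_vcompletion x * to_vcompletion y"
  by transfer simp

lemma to_vcompletion_minus: "to_vcompletion (- x) = - to_vcompletion x"
  by transfer simp

lemma to_vcompletion_diff: "to_vcompletion (x - y) = to_vcompletion x - to_vcompletion y"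
  using to_vcompletion_add[of x "- y"] by (simp add: to_vcompletion_minus)

lemma to_vcompletion_0 [simp]: "to_vcompletion 0 = 0"
  by transfer simp

lemma to_vcompletion_1 [simp]: "to_vcompletion 1 = 1"
  by transfer simp

lemma to_vcompletion_eq_iff [simp]: "to_vcompletion x = to_vcompletion y \<longleftrightarrow> x = y"
  by transfer (simp add: cauchy_rel_def LIMSEQ_const_iff)

lemma to_vcompletion_of_nat [simp]: "to_vcompletion (of_nat n) = of_nat n"
  by (induction n) (simp_all add: to_vcompletion_add)

instance vcompletion :: (valued_field) field_char_0
proof
  show "inj (of_nat :: nat \<Rightarrow> 'a vcompletion)"
    by (rule injI) (simp flip: to_vcompletion_of_nat)
qed

lemma vabs_add_le: "vabs (x + y) \<le> vabs x + vabs y" for x y :: "'a :: valued_field"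
  using vabs_ultra[of x y] vabs_nonneg[of x] vabs_nonneg[of y] by linarith

instantiation vcompletion :: (valued_field) valued_field
begin

lift_definition vabs_vcompletion :: "'a vcompletion \<Rightarrow> real" is "\<lambda>s. lim (\<lambda>n. vabs (s n))"
proof -
  fix s t :: "nat \<Rightarrow> 'a"
  assume *: "cauchy_rel s t"
  then have C: "Cauchy s" "Cauchy t" and 0: "(\<lambda>n. vabs (s n - t n)) \<longlonglongrightarrow> 0"
    by (auto simp: cauchy_rel_def tendsto_vabs_iff[of "\<lambda>n. s n - t n"])
  have "(\<lambda>n. vabs (s n) - vabs (t n)) \<longlonglongrightarrow> 0"
    by (rule tendsto_0_sandwich[OF _ 0]) (simp add: abs_vabs_diff_le)
  moreover have "(\<lambda>n. vabs (s n) - vabs (t n)) \<longlonglongrightarrow>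
      lim (\<lambda>n. vabs (s n)) - lim (\<lambda>n. vabs (t n))"
    by (intro tendsto_diff Cauchy_vabs_tendsto C)
  ultimately show "lim (\<lambda>n. vabs (s n)) = lim (\<lambda>n. vabs (t n))"
    using LIMSEQ_unique by fastforce
qed

definition "dist x y = vabs (x - y)" for x y :: "'a vcompletion"

definition [code del]:
  "(uniformity :: ('a vcompletion \<times> 'a vcompletion) filter)
     = (INF e\<in>{0 <..}. principal {(x, y). dist x y < e})"

definition [code del]:
  "open (U :: 'a vcompletion set)
     \<longleftrightarrow> (\<forall>x\<in>U. \<forall>\<^sub>F (x', y) in uniformity. x' = x \<longrightarrow> y \<in> U)"

instance
proof
  have mult: "vabs (x * y) = vabs x * vabs y" for x y :: "'a vcompletion"
  proof transfer
    fix s t :: "nat \<Rightarrow> 'a"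
    assume "cauchy_rel s s" "cauchy_rel t t"
    then have C: "Cauchy s" "Cauchy t"
      by simp_all
    show "lim (\<lambda>n. vabs (s n * t n)) = lim (\<lambda>n. vabs (s n)) * lim (\<lambda>n. vabs (t n))"
      unfolding vabs_mult by (rule limI) (intro tendsto_mult Cauchy_vabs_tendsto C)
  qed
  have ultra: "vabs (x + y) \<le> max (vabs x) (vabs y)" for x y :: "'a vcompletion"
  proof transfer
    fix s t :: "nat \<Rightarrow> 'a"
    assume "cauchy_rel s s" "cauchy_rel t t"
    then have C: "Cauchy s" "Cauchy t"
      by simp_all
    show "lim (\<lambda>n. vabs (s n + t n)) \<le> max (lim (\<lambda>n. vabs (s n))) (lim (\<lambda>n. vabs (t n)))"
      by (rule LIMSEQ_le[OF Cauchy_vabs_tendsto[OF Cauchy_vadd[OF C]]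
            tendsto_max[OF Cauchy_vabs_tendsto[OF C(1)] Cauchy_vabs_tendsto[OF C(2)]]])
         (simp add: vabs_ultra)
  qed
  have zero: "vabs x = 0 \<longleftrightarrow> x = 0" for x :: "'a vcompletion"
  proof transfer
    fix s :: "nat \<Rightarrow> 'a"
    assume "cauchy_rel s s"
    then have C: "Cauchy s"
      by simp
    show "lim (\<lambda>n. vabs (s n)) = 0 \<longleftrightarrow> cauchy_rel s (\<lambda>_. 0)"
      using Cauchy_vabs_tendsto[OF C] C
      by (auto simp: cauchy_rel_def tendsto_vabs_iff[of s] intro: limI)
  qed
  have nonneg: "0 \<le> vabs x" for x :: "'a vcompletion"
  proof transfer
    fix s :: "nat \<Rightarrow> 'a"
    assume "cauchy_rel s s"
    then show "0 \<le> lim (\<lambda>n. vabs (s n))"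
      by (intro LIMSEQ_le_const[OF Cauchy_vabs_tendsto]) simp_all
  qed
  have minus: "vabs (- x) = vabs x" for x :: "'a vcompletion"
    by transfer simp
  fix x y z :: "'a vcompletion"
  show "dist x y = vabs (x - y)"
    by (simp add: dist_vcompletion_def)
  show "vabs (x * y) = vabs x * vabs y"
    by (rule mult)
  show "vabs (x + y) \<le> max (vabs x) (vabs y)"
    by (rule ultra)
  show "dist x y = 0 \<longleftrightarrow> x = y"
    by (simp add: dist_vcompletion_def zero)
  show "dist x y \<le> dist x z + dist y z"
    using ultra[of "x - z" "z - y"] minus[of "y - z"] nonneg[of "x - z"] nonneg[of "y - z"]
    by (simp add: dist_vcompletion_def)
qed (simp_all only: uniformity_vcompletion_def open_vcompletion_def)

end

lemma vabs_to_vcompletion [simp]: "vabs (to_vcompletion x) = vabs x"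
  by transfer simp

lemma vabs_abs_vcompletion_diff:
  fixes s :: "nat \<Rightarrow> 'a :: valued_field"
  assumes s: "Cauchy s" and le: "\<And>n. n \<ge> M \<Longrightarrow> vabs (s n - c) \<le> e"
  shows "vabs (abs_vcompletion s - to_vcompletion c) \<le> e"
proof -
  have "abs_vcompletion s - to_vcompletion c = abs_vcompletion (\<lambda>n. s n - c)"
    using s by (simp add: to_vcompletion.abs_eq minus_vcompletion_def uminus_vcompletion.abs_eq
        plus_vcompletion.abs_eq Cauchy_vadd)
  also have "vabs \<dots> = lim (\<lambda>n. vabs (s n - c))"
    using s by (simp add: vabs_vcompletion.abs_eq Cauchy_vdiff)
  also have "\<dots> \<le> e"
    using le by (intro LIMSEQ_le_const2[OF Cauchy_vabs_tendsto] Cauchy_vdiff s) auto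
  finally show ?thesis .
qed

lemma to_vcompletion_dense:
  fixes x :: "'a :: valued_field vcompletion"
  assumes "e > 0"
  obtains c where "vabs (x - to_vcompletion c) < e"
proof -
  obtain s where s: "Cauchy s" and x: "x = abs_vcompletion s"
    by (metis Quotient3_abs_rep Quotient3_rel_rep Quotient3_vcompletion cauchy_rel_def)
  obtain M where M: "\<And>m n. m \<ge> M \<Longrightarrow> n \<ge> M \<Longrightarrow> vabs (s m - s n) < e / 2"
    using s assms unfolding Cauchy_vabs_iff by (meson half_gt_zero)
  have "vabs (x - to_vcompletion (s M)) \<le> e / 2"
    unfolding x using M by (intro vabs_abs_vcompletion_diff[OF s, of M]) (auto intro: less_imp_le)
  then show ?thesis
    using that[of "s M"] assms by simp
qed

instance vcompletion :: (valued_field) complete_space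
proof
  fix S :: "nat \<Rightarrow> 'a vcompletion"
  assume S: "Cauchy S"
  have "\<exists>c. vabs (S n - to_vcompletion c) < inverse (real (Suc n))" for n
    by (rule to_vcompletion_dense[of "inverse (real (Suc n))" "S n"]) auto
  then obtain c where c: "\<And>n. vabs (S n - to_vcompletion (c n)) < inverse (real (Suc n))"
    by metis
  have small: "\<exists>N. \<forall>n\<ge>N. inverse (real (Suc n)) < e" if e: "e > 0" for e :: real
    using LIMSEQ_inverse_real_of_nat order_tendstoD(2) e
    unfolding eventually_sequentially[symmetric] by blast
  have cC: "Cauchy c"
    unfolding Cauchy_vabs_iff
  proof (intro allI impI)
    fix e :: real
    assume "0 < e"
    obtain M where M: "\<And>m n. m \<ge> M \<Longrightarrow> n \<ge> M \<Longrightarrow> vabs (S m - S n) < e"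
      using S \<open>0 < e\<close> unfolding Cauchy_vabs_iff by blast
    obtain N where N: "\<And>n. n \<ge> N \<Longrightarrow> inverse (real (Suc n)) < e"
      using small[OF \<open>0 < e\<close>] by blast
    have "vabs (c m - c n) < e" if "m \<ge> max M N" "n \<ge> max M N" for m n
    proof -
      have "vabs (c m - c n) = vabs (to_vcompletion (c m) - to_vcompletion (c n))"
        by (simp flip: to_vcompletion_diff)
      also have "to_vcompletion (c m) - to_vcompletion (c n)
          = (S n - to_vcompletion (c n)) - (S m - to_vcompletion (c m)) + (S m - S n)"
        by simp
      also have "vabs \<dots> \<le> max (max (vabs (S n - to_vcompletion (c n)))
          (vabs (S m - to_vcompletion (c m)))) (vabs (S m - S n))"
        by (meson vabs_ultra vabs_ultra_diff max.mono order.trans order_refl)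
      also have "\<dots> < e"
        using that M[of m n] N[of m] N[of n] c[of m] c[of n] by auto
      finally show ?thesis .
    qed
    then show "\<exists>M. \<forall>m\<ge>M. \<forall>n\<ge>M. vabs (c m - c n) < e"
      by blast
  qed
  have "S \<longlonglongrightarrow> abs_vcompletion c"
  proof (rule metric_LIMSEQ_I)
    fix e :: real
    assume "0 < e"
    obtain M where M: "\<And>m n. m \<ge> M \<Longrightarrow> n \<ge> M \<Longrightarrow> vabs (c m - c n) < e / 2"
      using cC \<open>0 < e\<close> unfolding Cauchy_vabs_iff by (meson half_gt_zero)
    obtain N where N: "\<And>n. n \<ge> N \<Longrightarrow> inverse (real (Suc n)) < e"
      using small[OF \<open>0 < e\<close>] by blast
    have "dist (S n) (abs_vcompletion c) < e" if "n \<ge> max M N" for n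
    proof -
      have "vabs (abs_vcompletion c - to_vcompletion (c n)) \<le> e / 2"
        using M that by (intro vabs_abs_vcompletion_diff[OF cC, of M]) (auto intro: less_imp_le)
      moreover have "vabs (S n - to_vcompletion (c n)) < e"
        using c[of n] N[of n] that by simp
      ultimately show ?thesis
        using vabs_ultra_diff[of "S n - to_vcompletion (c n)" "abs_vcompletion c - to_vcompletion (c n)"]
          \<open>0 < e\<close> by (simp add: dist_vabs)
    qed
    then show "\<exists>N. \<forall>n\<ge>N. dist (S n) (abs_vcompletion c) < e"
      by blast
  qed
  then show "convergent S"
    by (rule convergentI)
qed


section \<open>Extension of the absolute value to the algebraic closure\<close>

definition extends_vabs :: "('a :: valued_field alg_closure \<Rightarrow> real) \<Rightarrow> bool" where
  "extends_vabs N \<longleftrightarrow>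
     (\<forall>x. 0 \<le> N x) \<and>
     (\<forall>x y. N (x * y) = N x * N y) \<and>
     (\<forall>x y. N (x + y) \<le> max (N x) (N y)) \<and>
     (\<forall>c. N (to_ac c) = vabs c)"

text \<open>
  Existence is shown as in Chevalley's extension theorem: a maximal subring of the algebraic closure
  that meets the base field exactly in its valuation ring is itself a valuation ring, and since the
  extension is algebraic, every nonzero element has a power that is a unit multiple of an element
  of the base field.
\<close>

definition dominating_subring :: "'a :: valued_field alg_closure set \<Rightarrow> bool" where
  "dominating_subring R \<longleftrightarrow>
     (\<forall>x\<in>R. \<forall>y\<in>R. x + y \<in> R) \<and> (\<forall>x\<in>R. \<forall>y\<in>R. x * y \<in> R) \<and>
     (\<forall>c. to_ac c \<in> R \<longleftrightarrow> vabs c \<le> 1)"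

lemma dominating_subringD:
  assumes "dominating_subring R"
  shows "x \<in> R \<Longrightarrow> y \<in> R \<Longrightarrow> x + y \<in> R"
    and "x \<in> R \<Longrightarrow> y \<in> R \<Longrightarrow> x * y \<in> R"
    and "to_ac c \<in> R \<longleftrightarrow> vabs c \<le> 1"
    and "0 \<in> R" and "1 \<in> R" and "x \<in> R \<Longrightarrow> - x \<in> R"
proof -
  show 1: "x \<in> R \<Longrightarrow> y \<in> R \<Longrightarrow> x + y \<in> R" and 2: "x \<in> R \<Longrightarrow> y \<in> R \<Longrightarrow> x * y \<in> R"
    and 3: "to_ac c \<in> R \<longleftrightarrow> vabs c \<le> 1" for x y c
    using assms by (auto simp: dominating_subring_def)
  show "0 \<in> R" "1 \<in> R"
    using 3[of 0] 3[of 1] by simp_all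
  have "- 1 \<in> R"
    using 3[of "- 1"] by simp
  then show "x \<in> R \<Longrightarrow> - x \<in> R"
    using 2[of "- 1" x] by simp
qed

lemma dominating_subring_sum:
  assumes "dominating_subring R" "\<And>i. i \<in> A \<Longrightarrow> f i \<in> R"
  shows "sum f A \<in> R"
  using assms(2) by (induction A rule: infinite_finite_induct)
    (auto intro: dominating_subringD[OF assms(1)])

lemma dominating_subring_power:
  assumes "dominating_subring R" "x \<in> R"
  shows "x ^ n \<in> R"
  by (induction n) (auto intro: dominating_subringD[OF assms(1)] assms)

lemma maximal_dominating_subring:
  obtains R :: "'a :: valued_field alg_closure set"
  where "dominating_subring R" "\<And>R'. dominating_subring R' \<Longrightarrow> R \<subseteq> R' \<Longrightarrow> R' = R"
proof -
  let ?A = "Collect (dominating_subring :: 'a alg_closure set \<Rightarrow> bool)"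
  have "\<exists>M\<in>?A. \<forall>R\<in>?A. M \<subseteq> R \<longrightarrow> R = M"
  proof (rule subset_Zorn_nonempty)
    have "dominating_subring (to_ac ` {c :: 'a. vabs c \<le> 1})"
      unfolding dominating_subring_def
    proof (intro conjI ballI allI)
      fix x y :: "'a alg_closure"
      assume "x \<in> to_ac ` {c. vabs c \<le> 1}" "y \<in> to_ac ` {c. vabs c \<le> 1}"
      then obtain c d where cd: "x = to_ac c" "y = to_ac d" "vabs c \<le> 1" "vabs d \<le> 1"
        by blast
      have "vabs (c + d) \<le> 1" "vabs (c * d) \<le> 1"
        using vabs_ultra[of c d] cd by (auto simp: vabs_mult intro: mult_le_one)
      then show "x + y \<in> to_ac ` {c. vabs c \<le> 1}" "x * y \<in> to_ac ` {c. vabs c \<le> 1}"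
        using cd to_ac_add[of c d] to_ac_mult[of c d] by (metis (mono_tags) imageI mem_Collect_eq)+
    next
      show "to_ac c \<in> to_ac ` {c :: 'a. vabs c \<le> 1} \<longleftrightarrow> vabs c \<le> 1" for c :: 'a
        by (simp add: inj_image_mem_iff[OF inj_to_ac])
    qed
    then show "?A \<noteq> {}"
      by blast
  next
    fix C
    assume ne: "C \<noteq> {}" and chain: "subset.chain ?A C"
    then have dom: "dominating_subring R" if "R \<in> C" for R
      using that by (auto simp: subset_chain_def)
    have two: "\<exists>R\<in>C. x \<in> R \<and> y \<in> R" if "x \<in> \<Union>C" "y \<in> \<Union>C" for x y
      using that chain unfolding subset_chain_def by blast
    have "dominating_subring (\<Union>C)"
      unfolding dominating_subring_def
    proof (intro conjI ballI allI)
      show "x + y \<in> \<Union>C" "x * y \<in> \<Union>C" if "x \<in> \<Union>C" "y \<in> \<Union>C" for x y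
        using two[OF that] dominating_subringD(1,2)[OF dom] by blast+
      show "to_ac c \<in> \<Union>C \<longleftrightarrow> vabs c \<le> 1" for c
        using ne dominating_subringD(3)[OF dom] by blast
    qed
    then show "\<Union>C \<in> ?A"
      by simp
  qed
  then show ?thesis
    using that by blast
qed

lemma poly_in_dominating_subring:
  assumes R: "dominating_subring R" and q: "\<And>i. Polynomial.coeff q i \<in> R"
    and q': "\<And>i. Polynomial.coeff q' i \<in> R"
  shows "Polynomial.coeff (q + q') i \<in> R" "Polynomial.coeff (q * q') i \<in> R"
  by (auto simp: coeff_mult q q' intro!: dominating_subring_sum[OF R] dominating_subringD[OF R])

lemma maximal_dominating_subring_total:
  fixes R :: "'a :: valued_field alg_closure set"
  assumes R: "dominating_subring R"
    and maximal: "\<And>R'. dominating_subring R' \<Longrightarrow> R \<subseteq> R' \<Longrightarrow> R' = R"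
  shows "x \<in> R \<or> inverse x \<in> R"
proof (rule ccontr)
  note RD = dominating_subringD[OF R]
  define I where "I = {r / to_ac c | r c. r \<in> R \<and> vabs (c :: 'a) > 1}"
  have I_sub: "z \<in> R" if "z \<in> I" for z
  proof -
    from that obtain r c where z: "z = r / to_ac c" "r \<in> R" "vabs c > 1"
      by (auto simp: I_def)
    have "to_ac (inverse c) \<in> R"
      using z by (simp only: RD vabs_inverse) (simp add: inverse_le_1_iff)
    then have "r * to_ac (inverse c) \<in> R"
      using RD(2) z by blast
    then show ?thesis
      by (simp add: z field_simps)
  qed
  have I_add: "z + w \<in> I" if zw: "z \<in> I" "w \<in> I" for z w
  proof -
    have *: "r / to_ac c + s / to_ac d \<in> I"
      if "r \<in> R" "s \<in> R" "vabs c > 1" "vabs d > 1" "vabs c \<le> vabs d" for r s c d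
    proof -
      have nz: "c \<noteq> 0" "d \<noteq> 0"
        using that by auto
      have "to_ac (c / d) \<in> R"
        using that nz by (simp only: RD vabs_divide) (simp add: divide_le_eq_1)
      then have "r + s * to_ac (c / d) \<in> R"
        using that by (intro RD)
      moreover have "r / to_ac c + s / to_ac d = (r + s * to_ac (c / d)) / to_ac c"
        using nz by (simp add: add_divide_distrib)
      ultimately show ?thesis
        using that unfolding I_def by blast
    qed
    from zw obtain r c s d where "z = r / to_ac c" "r \<in> R" "vabs c > 1"
        "w = s / to_ac d" "s \<in> R" "vabs d > 1"
      by (auto simp: I_def)
    then show ?thesis
      using *[of r s c d] *[of s r d c] by (cases "vabs c \<le> vabs d") (auto simp: add.commute)
  qed
  have I_mult: "r * z \<in> I" if "r \<in> R" "z \<in> I" for r z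
  proof -
    from \<open>z \<in> I\<close> obtain s c where z: "z = s / to_ac c" "s \<in> R" "vabs c > 1"
      by (auto simp: I_def)
    then have "r * z = (r * s) / to_ac c" "r * s \<in> R"
      using RD(2) that by auto
    then show ?thesis
      using z unfolding I_def by blast
  qed
  have I_1: "1 \<notin> I"
  proof
    assume "1 \<in> I"
    then obtain r c where rc: "1 = r / to_ac c" "r \<in> R" "vabs c > 1"
      by (auto simp: I_def)
    then have "r = to_ac c"
      by (metis divide_eq_1_iff)
    then show False
      using rc RD(3) by simp
  qed
  have I_0: "0 \<in> I" if "I \<noteq> {}"
    using that I_mult[OF RD(4)] by fastforce
  have I_diff: "z - w \<in> I" if "z \<in> I" "w \<in> I" for z w
    using I_add[OF that(1) I_mult[OF RD(6)[OF RD(5)] that(2)]] by simp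

  have rel: "\<exists>q. (\<forall>i. Polynomial.coeff q i \<in> I) \<and> poly q z = 1" if z: "z \<notin> R" for z
  proof -
    define S where "S = {poly q z | q. \<forall>i. Polynomial.coeff q i \<in> R}"
    have const: "\<forall>i. Polynomial.coeff [:r:] i \<in> R" if "r \<in> R" for r
      using that RD(4) by (auto simp: coeff_pCons split: nat.split)
    have "R \<subseteq> S"
    proof
      fix r assume "r \<in> R"
      then show "r \<in> S"
        using const[of r] unfolding S_def by (intro CollectI exI[of _ "[:r:]"]) auto
    qed
    have "z \<in> S"
      unfolding S_def using RD(4,5)
      by (intro CollectI exI[of _ "[:0, 1:]"]) (auto simp: coeff_pCons split: nat.split)
    then have "\<not> dominating_subring S"
      using maximal[of S] \<open>R \<subseteq> S\<close> z by blast
    moreover have "x + y \<in> S" "x * y \<in> S" if "x \<in> S" "y \<in> S" for x y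
    proof -
      from that obtain q q' where q: "x = poly q z" "y = poly q' z"
          "\<And>i. Polynomial.coeff q i \<in> R" "\<And>i. Polynomial.coeff q' i \<in> R"
        by (auto simp: S_def)
      show "x + y \<in> S"
        unfolding S_def using poly_in_dominating_subring(1)[OF R q(3,4)]
        by (intro CollectI exI[of _ "q + q'"]) (auto simp: q)
      show "x * y \<in> S"
        unfolding S_def using poly_in_dominating_subring(2)[OF R q(3,4)]
        by (intro CollectI exI[of _ "q * q'"]) (auto simp: q)
    qed
    moreover have "to_ac c \<in> S" if "vabs c \<le> 1" for c
      using that RD(3) \<open>R \<subseteq> S\<close> by blast
    ultimately obtain c where c: "to_ac c \<in> S" "vabs c > 1"
      unfolding dominating_subring_def by force
    then obtain q where q: "to_ac c = poly q z" "\<And>i. Polynomial.coeff q i \<in> R"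
      by (auto simp: S_def)
    have "c \<noteq> 0"
      using c(2) by auto
    have "Polynomial.coeff (Polynomial.smult (inverse (to_ac c)) q) i \<in> I" for i
      using q(2)[of i] c(2) unfolding I_def
      by (auto simp: field_simps)
    moreover have "poly (Polynomial.smult (inverse (to_ac c)) q) z = 1"
      using \<open>c \<noteq> 0\<close> by (simp flip: q(1))
    ultimately show ?thesis
      by blast
  qed

  have key: False
    if "z \<noteq> 0" "\<And>i. Polynomial.coeff q i \<in> I" "poly q z = 1"
      "\<And>i. Polynomial.coeff q' i \<in> I" "poly q' (inverse z) = 1" for z q q'
    using that
  proof (induction "Polynomial.degree q + Polynomial.degree q'" arbitrary: z q q' rule: less_induct)
    case (less q q' z)
    have step: False
      if "w \<noteq> 0" and a: "\<And>i. Polynomial.coeff a i \<in> I" "poly a w = 1"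
        and b: "\<And>i. Polynomial.coeff b i \<in> I" "poly b (inverse w) = 1"
        and le: "Polynomial.degree b \<le> Polynomial.degree a"
        and IH: "\<And>a'. (\<And>i. Polynomial.coeff a' i \<in> I) \<Longrightarrow> poly a' w = 1 \<Longrightarrow>
          Polynomial.degree a' < Polynomial.degree a \<Longrightarrow> False" for w a b
    proof -
      define n where "n = Polynomial.degree a"
      define m where "m = Polynomial.degree b"
      have I0: "0 \<in> I"
        using I_0 a(1) by blast
      have "n \<noteq> 0"
      proof
        assume "n = 0"
        then obtain k where "a = [:k:]"
          unfolding n_def by (meson degree_eq_zeroE)
        then show False
          using a(1)[of 0] a(2) I_1 by simp
      qed
      define b0 where "b0 = Polynomial.coeff b 0"
      define Q where "Q = Polynomial.monom 1 (n - m) * reflect_poly b"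
      have Q_coeff: "Polynomial.coeff Q i \<in> I" for i
        using b(1) I0 by (auto simp: Q_def coeff_monom_mult coeff_reflect_poly)
      have Q_n: "Polynomial.coeff Q n = b0"
        using le by (simp add: Q_def coeff_monom_mult coeff_reflect_poly b0_def n_def m_def)
      have Q_gt: "Polynomial.coeff Q i = 0" if "i > n" for i
        using that le by (auto simp: Q_def coeff_monom_mult coeff_reflect_poly n_def m_def)
      have Q_w: "poly Q w = w ^ n"
        using \<open>w \<noteq> 0\<close> b(2) le
        by (simp add: Q_def poly_monom poly_reflect_poly_nz n_def m_def flip: power_add)
      define Q' where "Q' = Q - Polynomial.monom b0 n"
      define a' where "a' = a - Polynomial.monom (Polynomial.coeff a n) n"
      define T where "T = [:b0:] + Polynomial.smult (Polynomial.coeff a n) Q'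
        + Polynomial.smult (1 - b0) a'"
      have b0I: "b0 \<in> I" and b0R: "1 - b0 \<in> R"
        using b(1) I_sub RD(1)[OF RD(5) RD(6)] by (auto simp: b0_def)
      have Q'I: "Polynomial.coeff Q' i \<in> I" for i
        using Q_coeff Q_n I0 by (auto simp: Q'_def)
      have a'I: "Polynomial.coeff a' i \<in> I" for i
        using a(1) I0 by (auto simp: a'_def)
      have "Polynomial.coeff T i \<in> I" for i
        unfolding T_def
        by (auto simp: coeff_pCons b0I I0 split: nat.split
            intro!: I_add I_mult[OF b0R a'I] I_mult[OF I_sub[OF a(1)] Q'I])
      moreover have "Polynomial.degree T < n"
      proof (rule degree_lessI)
        show "\<forall>k\<ge>n. Polynomial.coeff T k = 0"
          using Q_n Q_gt coeff_eq_0[of a] \<open>n \<noteq> 0\<close>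
          by (auto simp: T_def Q'_def a'_def coeff_pCons n_def split: nat.split)
      qed (use \<open>n \<noteq> 0\<close> in auto)
      moreover have "poly T w = 1"
      proof -
        have "poly a' w = 1 - Polynomial.coeff a n * w ^ n"
          using a(2) by (simp add: a'_def poly_monom)
        moreover have "poly Q' w = (1 - b0) * w ^ n"
          using Q_w by (simp add: Q'_def poly_monom algebra_simps)
        ultimately have "poly T w = b0 + Polynomial.coeff a n * ((1 - b0) * w ^ n)
            + (1 - b0) * (1 - Polynomial.coeff a n * w ^ n)"
          by (simp add: T_def)
        then show ?thesis
          by (simp add: algebra_simps)
      qed
      ultimately show False
        using IH[of T] by (simp add: n_def)
    qed
    show False
    proof (cases "Polynomial.degree q' \<le> Polynomial.degree q")
      case True
      show False
      proof (rule step[OF less.prems True])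
        show False if "\<And>i. Polynomial.coeff a' i \<in> I" "poly a' z = 1"
          "Polynomial.degree a' < Polynomial.degree q" for a'
          by (rule less.hyps[OF _ less.prems(1) that(1,2) less.prems(4,5)]) (use that(3) in simp)
      qed
    next
      case False
      show False
      proof (rule step[of "inverse z" q' q])
        show False if "\<And>i. Polynomial.coeff a' i \<in> I" "poly a' (inverse z) = 1"
          "Polynomial.degree a' < Polynomial.degree q'" for a'
          by (rule less.hyps[OF _ less.prems(1-3) that(1,2)]) (use that(3) in simp)
      qed (use less.prems False in simp_all)
    qed
  qed

  assume "\<not> (x \<in> R \<or> inverse x \<in> R)"
  then have "x \<notin> R" "inverse x \<notin> R"
    by auto
  moreover have "x \<noteq> 0"
    using \<open>x \<notin> R\<close> RD(4) by auto
  ultimately show False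
    using rel[of x] rel[of "inverse x"] key[of x] by blast
qed

lemma exists_maximal_in_preorder:
  assumes "finite A" "A \<noteq> {}"
    and "\<And>x y. x \<in> A \<Longrightarrow> y \<in> A \<Longrightarrow> r x y \<or> r y x"
    and "\<And>x y z. x \<in> A \<Longrightarrow> y \<in> A \<Longrightarrow> z \<in> A \<Longrightarrow> r x y \<Longrightarrow> r y z \<Longrightarrow> r x z"
  shows "\<exists>m\<in>A. \<forall>x\<in>A. r x m"
  using assms
proof (induction A rule: finite_ne_induct)
  case (insert a A)
  have "\<exists>m\<in>A. \<forall>x\<in>A. r x m"
    by (rule insert.IH) (use insert.prems in blast)+
  then obtain m where m: "m \<in> A" "\<forall>x\<in>A. r x m"
    by blast
  have "r a a" 
    using insert.prems(1)[of a a] by blast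
  consider "r a m" | "r m a"
    using insert.prems(1)[of a m] m by blast
  then show ?case
  proof cases
    case 1
    then show ?thesis
      using m by blast
  next
    case 2
    then have "r x a" if "x \<in> A" for x
      using insert.prems(2)[of x m a] m that by blast
    then show ?thesis
      using \<open>r a a\<close> by blast
  qed
qed blast

lemma alg_closure_power_associate:
  fixes R :: "'a :: valued_field alg_closure set"
  assumes R: "dominating_subring R" and total: "\<And>x. x \<in> R \<or> inverse x \<in> R"
    and "x \<noteq> 0"
  obtains n c where "n > 0" "c \<noteq> 0" "x ^ n / to_ac c \<in> R" "to_ac c / x ^ n \<in> R"
proof -
  note RD = dominating_subringD[OF R]
  obtain P :: "'a poly" where P: "P \<noteq> 0" "poly (map_poly to_ac P) x = 0"
    by (rule alg_closure_algebraic)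
  define a where "a = Polynomial.coeff P"
  define t where "t i = to_ac (a i) * x ^ i" for i
  define J where "J = {i. i \<le> Polynomial.degree P \<and> a i \<noteq> 0}"
  have fin: "finite J"
    unfolding J_def by simp
  have "Polynomial.degree P \<in> J"
    using P(1) by (simp add: J_def a_def)
  have t_nz: "t i \<noteq> 0" if "i \<in> J" for i
    using that \<open>x \<noteq> 0\<close> by (simp add: J_def t_def)
  have "(\<Sum>i\<le>Polynomial.degree P. t i) = 0"
    using P(2) by (simp add: poly_altdef degree_map_poly coeff_map_poly t_def a_def)
  moreover have "(\<Sum>i\<le>Polynomial.degree P. t i) = sum t J"
    by (rule sum.mono_neutral_right) (auto simp: J_def t_def)
  ultimately have sum0: "sum t J = 0"
    by simp
  have ex_max: "\<exists>m\<in>A. \<forall>i\<in>A. t i / t m \<in> R" if "A \<subseteq> J" "A \<noteq> {}" for A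
  proof (rule exists_maximal_in_preorder)
    show "finite A"
      using finite_subset[OF that(1) fin] .
    show "t i / t j \<in> R \<or> t j / t i \<in> R" for i j
      using total[of "t i / t j"] by simp
    show "t i / t k \<in> R" if "i \<in> A" "j \<in> A" "k \<in> A" "t i / t j \<in> R" "t j / t k \<in> R" for i j k
    proof -
      have "t i / t k = t i / t j * (t j / t k)"
        using t_nz[of j] that \<open>A \<subseteq> J\<close> by auto
      then show ?thesis
        using that RD(2) by metis
    qed
  qed (use that in auto)
  obtain i where i: "i \<in> J" "\<And>k. k \<in> J \<Longrightarrow> t k / t i \<in> R"
    using ex_max[of J] \<open>Polynomial.degree P \<in> J\<close> by blast
  have split: "t i + sum t (J - {i}) = 0"
    using sum0 sum.remove[OF fin i(1), of t] by simp
  have "J - {i} \<noteq> {}"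
  proof
    assume "J - {i} = {}"
    with split t_nz[OF i(1)] show False
      by simp
  qed
  then obtain j where j: "j \<in> J - {i}" "\<And>k. k \<in> J - {i} \<Longrightarrow> t k / t j \<in> R"
    using ex_max[of "J - {i}"] by blast
  have tj: "t j \<noteq> 0"
    using t_nz j by blast
  have "t i = - sum t (J - {i})"
    using split by (simp add: eq_neg_iff_add_eq_0)
  then have "t i / t j = - (\<Sum>k\<in>J - {i}. t k / t j)"
    by (simp add: sum_divide_distrib)
  also have "\<dots> \<in> R"
    by (intro RD dominating_subring_sum[OF R] j)
  finally have ij: "t i / t j \<in> R" .
  have ji: "t j / t i \<in> R"
    using i(2) j(1) by blast
  have nz: "a i \<noteq> 0" "a j \<noteq> 0"
    using i j by (auto simp: J_def)
  have conv: "x ^ (l - k) / to_ac (a k / a l) = t l / t k" if "k < l" "a k \<noteq> 0" "a l \<noteq> 0" for k l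
  proof -
    have "x ^ l = x ^ (l - k) * x ^ k"
      using that by (simp flip: power_add)
    then show ?thesis
      using that \<open>x \<noteq> 0\<close> by (simp add: t_def field_simps)
  qed
  have conv': "to_ac (a k / a l) / x ^ (l - k) = t k / t l" if "k < l" "a k \<noteq> 0" "a l \<noteq> 0" for k l
    using arg_cong[OF conv[OF that], of inverse] by (simp add: mult.commute)
  consider "i < j" | "j < i"
    using j(1) by (auto simp: nat_neq_iff)
  then show ?thesis
  proof cases
    case 1
    show ?thesis
      by (rule that[of "j - i" "a i / a j"])
        (use 1 nz ij ji conv[OF 1] conv'[OF 1] in \<open>simp_all del: to_ac_divide\<close>)
  next
    case 2
    show ?thesis
      by (rule that[of "i - j" "a j / a i"])
        (use 2 nz ij ji conv[OF 2] conv'[OF 2] in \<open>simp_all del: to_ac_divide\<close>)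
  qed
qed

lemma power_swap: "(x ^ m) ^ n = (x ^ n) ^ m" for x :: "'b :: monoid_mult"
  by (simp only: mult.commute flip: power_mult)

theorem extends_vabs_exists: "\<exists>N :: 'a :: valued_field alg_closure \<Rightarrow> real. extends_vabs N"
proof -
  obtain R :: "'a alg_closure set" where R: "dominating_subring R"
    and maximal: "\<And>R'. dominating_subring R' \<Longrightarrow> R \<subseteq> R' \<Longrightarrow> R' = R"
    by (rule maximal_dominating_subring) blast
  note RD = dominating_subringD[OF R]
  have total: "x \<in> R \<or> inverse x \<in> R" for x
    using maximal_dominating_subring_total[OF R maximal] by blast
  define assoc where "assoc x n c \<longleftrightarrow>
      n > 0 \<and> c \<noteq> 0 \<and> x ^ n / to_ac c \<in> R \<and> to_ac c / x ^ n \<in> R" for x n and c :: 'a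
  have ex: "\<exists>n c. assoc x n c" if "x \<noteq> 0" for x
    using alg_closure_power_associate[OF R total that] unfolding assoc_def by metis
  have unit: "vabs k = 1" if "to_ac k \<in> R" "inverse (to_ac k) \<in> R" "k \<noteq> 0" for k
  proof -
    have "vabs k \<le> 1" "vabs (inverse k) \<le> 1"
      using that by (simp_all flip: RD(3))
    then show ?thesis
      using \<open>k \<noteq> 0\<close> vabs_pos_iff[of k] by (simp add: vabs_inverse inverse_le_1_iff del: vabs_pos_iff)
  qed
  have unique: "vabs c ^ m = vabs d ^ n" if x: "x \<noteq> 0" and "assoc x n c" "assoc x m d" for x n c m d
  proof -
    have nz: "c \<noteq> 0" "d \<noteq> 0"
      using that by (auto simp: assoc_def)
    let ?k = "c ^ m / d ^ n"
    have "to_ac ?k = (x ^ m / to_ac d) ^ n * (to_ac c / x ^ n) ^ m"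
      using x nz by (simp add: power_divide power_swap[of x m n])
    also have "\<dots> \<in> R"
      using that by (intro RD dominating_subring_power[OF R]) (auto simp: assoc_def)
    finally have 1: "to_ac ?k \<in> R" .
    have "inverse (to_ac ?k) = (to_ac d / x ^ m) ^ n * (x ^ n / to_ac c) ^ m"
      using x nz by (simp add: power_divide power_swap[of x m n])
    also have "\<dots> \<in> R"
      using that by (intro RD dominating_subring_power[OF R]) (auto simp: assoc_def)
    finally have "vabs ?k = 1"
      using 1 nz by (intro unit) auto
    then show ?thesis
      using nz by (simp add: vabs_divide vabs_power)
  qed
  define N where "N x = (if x = 0 then 0 else
      (SOME r. \<exists>n c. assoc x n c \<and> r = root n (vabs c)))" for x
  have N: "N x \<ge> 0 \<and> N x ^ n = vabs c" if x: "x \<noteq> 0" and "assoc x n c" for x n c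
  proof -
    have "\<exists>n c. assoc x n c \<and> N x = root n (vabs c)"
      unfolding N_def using someI_ex[of "\<lambda>r. \<exists>n c. assoc x n c \<and> r = root n (vabs c)"] ex[OF x] x
      by auto
    then obtain m d where md: "assoc x m d" "N x = root m (vabs d)"
      by blast
    then have m: "m > 0" and pos: "N x \<ge> 0" and "N x ^ m = vabs d"
      by (auto simp: assoc_def)
    then have "(N x ^ n) ^ m = vabs c ^ m"
      using unique[OF x that(2) md(1)] by (simp add: power_swap[of "N x" n m])
    then have "N x ^ n = vabs c"
      using m pos by (auto intro: power_eq_imp_eq_base)
    with pos show ?thesis
      by simp
  qed
  have N_0: "N 0 = 0"
    by (simp add: N_def)
  have nonneg: "N x \<ge> 0" for x
    using N[of x] ex[of x] N_0 by (cases "x = 0") (simp, blast)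
  have N_mult: "N (x * y) = N x * N y" for x y
  proof (cases "x = 0 \<or> y = 0")
    case False
    then have nz: "x \<noteq> 0" "y \<noteq> 0" "x * y \<noteq> 0"
      by auto
    obtain n c m d where x: "assoc x n c" and y: "assoc y m d"
      using ex nz by meson
    have "assoc (x * y) (n * m) (c ^ m * d ^ n)"
      unfolding assoc_def
    proof (intro conjI)
      have "(x * y) ^ (n * m) / to_ac (c ^ m * d ^ n) = (x ^ n / to_ac c) ^ m * (y ^ m / to_ac d) ^ n"
        by (simp add: power_divide power_mult_distrib power_mult power_swap[of y m n])
      also have "\<dots> \<in> R"
        using x y by (intro RD dominating_subring_power[OF R]) (auto simp: assoc_def)
      finally show "(x * y) ^ (n * m) / to_ac (c ^ m * d ^ n) \<in> R" .
      have "to_ac (c ^ m * d ^ n) / (x * y) ^ (n * m) = (to_ac c / x ^ n) ^ m * (to_ac d / y ^ m) ^ n"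
        by (simp add: power_divide power_mult_distrib power_mult power_swap[of y m n])
      also have "\<dots> \<in> R"
        using x y by (intro RD dominating_subring_power[OF R]) (auto simp: assoc_def)
      finally show "to_ac (c ^ m * d ^ n) / (x * y) ^ (n * m) \<in> R" .
    qed (use x y in \<open>auto simp: assoc_def\<close>)
    then have "N (x * y) ^ (n * m) = vabs (c ^ m * d ^ n)"
      using N nz by blast
    also have "\<dots> = (N x ^ n) ^ m * (N y ^ m) ^ n"
      using N[OF nz(1) x] N[OF nz(2) y] by (simp add: vabs_mult vabs_power)
    also have "\<dots> = (N x * N y) ^ (n * m)"
      by (simp only: power_mult_distrib power_mult power_swap[of "N y" m n])
    finally show ?thesis
      using x y nonneg by (intro power_eq_imp_eq_base[of "N (x * y)" "n * m"]) (auto simp: assoc_def)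
  qed (auto simp: N_0)
  have N_to_ac: "N (to_ac c) = vabs c" for c
  proof (cases "c = 0")
    case False
    then have "assoc (to_ac c) 1 c"
      using RD(5) by (simp add: assoc_def)
    then show ?thesis
      using N[of "to_ac c" 1 c] False by simp
  qed (simp add: N_0)
  have N_le_1: "N x \<le> 1" if "x \<in> R" for x
  proof (cases "x = 0")
    case False
    obtain n c where xc: "assoc x n c"
      using ex False by blast
    then have "to_ac c = x ^ n * (to_ac c / x ^ n)"
      using False by simp
    also have "\<dots> \<in> R"
      using xc that by (intro RD dominating_subring_power[OF R]) (auto simp: assoc_def)
    finally have "N x ^ n \<le> 1"
      using N[OF False xc] RD(3) by simp
    then show ?thesis
      using xc nonneg[of x] by (auto simp: assoc_def power_le_one_iff)
  qed (simp add: N_0)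
  have ultra1: "N (x + y) \<le> N x" if "x \<noteq> 0" "y / x \<in> R" for x y
  proof -
    have "N (x + y) = N (x * (1 + y / x))"
      using that(1) by (simp add: field_simps)
    also have "\<dots> = N x * N (1 + y / x)"
      by (rule N_mult)
    also have "\<dots> \<le> N x * 1"
      by (intro mult_left_mono N_le_1 nonneg RD that)
    finally show ?thesis
      by simp
  qed
  have N_ultra: "N (x + y) \<le> max (N x) (N y)" for x y
  proof (cases "x = 0 \<or> y = 0")
    case False
    then consider "y / x \<in> R" | "x / y \<in> R"
      using total[of "y / x"] by fastforce
    then show ?thesis
      using ultra1[of x y] ultra1[of y x] False by cases (auto simp: add.commute)
  qed auto
  have "extends_vabs N"
    unfolding extends_vabs_def using nonneg N_mult N_ultra N_to_ac by blast
  then show ?thesis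
    by - (rule exI[of _ N])
qed

text \<open>
  The extension is unique when the base field is complete, which is the only case used below.
\<close>

instantiation alg_closure :: (valued_field) valued_field
begin

definition "(vabs :: 'a alg_closure \<Rightarrow> real) = (SOME N. extends_vabs N)"

definition "dist x y = vabs (x - y)" for x y :: "'a alg_closure"

definition [code del]:
  "(uniformity :: ('a alg_closure \<times> 'a alg_closure) filter)
     = (INF e\<in>{0 <..}. principal {(x, y). dist x y < e})"

definition [code del]:
  "open (U :: 'a alg_closure set)
     \<longleftrightarrow> (\<forall>x\<in>U. \<forall>\<^sub>F (x', y) in uniformity. x' = x \<longrightarrow> y \<in> U)"

instance
proof
  have "extends_vabs (vabs :: 'a alg_closure \<Rightarrow> real)"
    unfolding vabs_alg_closure_def using extends_vabs_exists by (rule someI_ex)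
  then have nonneg: "0 \<le> vabs x" and mult: "vabs (x * y) = vabs x * vabs y"
    and ultra: "vabs (x + y) \<le> max (vabs x) (vabs y)"
    and ext: "vabs (to_ac c) = vabs c" for x y :: "'a alg_closure" and c
    unfolding extends_vabs_def by blast+
  have zero: "vabs x = 0 \<longleftrightarrow> x = 0" for x :: "'a alg_closure"
  proof
    assume "vabs x = 0"
    then show "x = 0"
      using mult[of x "inverse x"] ext[of 1] by (cases "x = 0") auto
  qed (use ext[of 0] in auto)
  have "vabs (- 1 :: 'a alg_closure) = 1"
    using ext[of "- 1"] by simp
  then have minus: "vabs (- x) = vabs x" for x :: "'a alg_closure"
    using mult[of "- 1" x] by simp
  fix x y z :: "'a alg_closure"
  show "dist x y = vabs (x - y)"
    by (simp add: dist_alg_closure_def)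
  show "vabs (x * y) = vabs x * vabs y"
    by (rule mult)
  show "vabs (x + y) \<le> max (vabs x) (vabs y)"
    by (rule ultra)
  show "dist x y = 0 \<longleftrightarrow> x = y"
    by (simp add: dist_alg_closure_def zero)
  show "dist x y \<le> dist x z + dist y z"
    using ultra[of "x - z" "z - y"] minus[of "y - z"] nonneg[of "x - z"] nonneg[of "y - z"]
    by (simp add: dist_alg_closure_def)
qed (simp_all only: uniformity_alg_closure_def open_alg_closure_def)

end

lemma vabs_to_ac [simp]: "vabs (to_ac c) = vabs c"
proof -
  have "extends_vabs (vabs :: 'a alg_closure \<Rightarrow> real)"
    unfolding vabs_alg_closure_def using extends_vabs_exists by (rule someI_ex)
  then show ?thesis
    by (simp add: extends_vabs_def)
qed


section \<open>The fields $\mathbb{Q}_p$ and $\mathbb{C}_p$\<close>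

text \<open>
  The prime \<open>p\<close> is the cardinality \<open>CARD('p)\<close> of a type \<open>'p\<close> of class
  \<open>prime_card\<close>. Every prime arises in this way.
\<close>

definition padic_abs :: "nat \<Rightarrow> rat \<Rightarrow> real" where
  "padic_abs p q = (if q = 0 then 0 else
     real p powi (int (multiplicity (int p) (snd (quotient_of q)))
                  - int (multiplicity (int p) (fst (quotient_of q)))))"

lemma padic_abs_frac:
  assumes "prime p" and "a \<noteq> 0" and "b \<noteq> 0"
  shows "padic_abs p (of_int a / of_int b) =
    real p powi (int (multiplicity (int p) b) - int (multiplicity (int p) a))"
proof -
  let ?q = "of_int a / of_int b :: rat"
  obtain n d where nd: "quotient_of ?q = (n, d)"
    by fastforce
  have d: "d \<noteq> 0"
    using quotient_of_denom_pos[OF nd] by simp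
  have q: "?q = of_int n / of_int d"
    using quotient_of_div[OF nd] .
  have "of_int (a * d) = (of_int (n * b) :: rat)"
    using q d assms by (simp add: field_simps)
  then have eq: "a * d = n * b"
    by (simp only: of_int_eq_iff)
  have n: "n \<noteq> 0"
    using eq d assms by auto
  have "prime_elem (int p)"
    using assms by simp
  then have "multiplicity (int p) a + multiplicity (int p) d
      = multiplicity (int p) n + multiplicity (int p) b"
    using arg_cong[OF eq, of "multiplicity (int p)"] assms n d
    by (simp add: prime_elem_multiplicity_mult_distrib)
  then have "int (multiplicity (int p) d) - int (multiplicity (int p) n)
      = int (multiplicity (int p) b) - int (multiplicity (int p) a)"
    by linarith
  then show ?thesis
    using assms by (simp add: padic_abs_def nd)
qed

lemma rat_frac_cases:
  fixes q :: rat
  obtains "q = 0" | a b where "q = of_int a / of_int b" "a \<noteq> 0" "b \<noteq> 0"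
proof (cases "q = 0")
  case False
  obtain n d where nd: "quotient_of q = (n, d)"
    by fastforce
  then show ?thesis
    using that(2)[of n d] quotient_of_div[OF nd] quotient_of_denom_pos[OF nd] False by auto
qed (use that in auto)

lemma padic_abs_0 [simp]: "padic_abs p 0 = 0"
  by (simp add: padic_abs_def)

lemma padic_abs_pos: "prime p \<Longrightarrow> q \<noteq> 0 \<Longrightarrow> padic_abs p q > 0"
  by (simp add: padic_abs_def prime_gt_0_nat)

lemma padic_abs_mult:
  assumes p: "prime p"
  shows "padic_abs p (q * r) = padic_abs p q * padic_abs p r"
proof (cases q rule: rat_frac_cases)
  case q: (2 a b)
  show ?thesis
  proof (cases r rule: rat_frac_cases)
    case r: (2 c d)
    have "prime_elem (int p)"
      using p by simp
    moreover have "q * r = of_int (a * c) / of_int (b * d)"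
      using q r by simp
    moreover have "real p \<noteq> 0"
      using p by auto
    ultimately show ?thesis
      using q r p by (simp only: padic_abs_frac[OF p] mult_eq_0_iff simp_thms flip: power_int_add)
        (simp add: prime_elem_multiplicity_mult_distrib algebra_simps)
  qed simp
qed simp

lemma padic_abs_ultra:
  assumes p: "prime p"
  shows "padic_abs p (q + r) \<le> max (padic_abs p q) (padic_abs p r)"
proof (cases q rule: rat_frac_cases)
  case q: (2 a b)
  show ?thesis
  proof (cases r rule: rat_frac_cases)
    case r: (2 c d)
    show ?thesis
    proof (cases "q + r = 0")
      case True
      then show ?thesis
        using padic_abs_pos[OF p, of q] q by simp
    next
      case False
      let ?v = "multiplicity (int p)"
      have sum: "q + r = of_int (a * d + c * b) / of_int (b * d)"
        using q r by (simp add: field_simps)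
      have q': "q = of_int (a * d) / of_int (b * d)" and r': "r = of_int (c * b) / of_int (b * d)"
        using q r by (simp_all add: field_simps)
      have nz: "a * d + c * b \<noteq> 0"
        using False sum by (metis div_0 of_int_0)
      have "int p ^ min (?v (a * d)) (?v (c * b)) dvd a * d + c * b"
        by (intro dvd_add multiplicity_dvd') simp_all
      moreover have "\<not> is_unit (int p)"
        using p by (metis not_prime_unit prime_int_nat_transfer of_nat_0_le_iff nat_int)
      ultimately have "min (?v (a * d)) (?v (c * b)) \<le> ?v (a * d + c * b)"
        using nz by (intro multiplicity_geI) auto
      then have "int (?v (b * d)) - int (?v (a * d + c * b)) \<le>
          max (int (?v (b * d)) - int (?v (a * d))) (int (?v (b * d)) - int (?v (c * b)))"
        by linarith
      then have "padic_abs p (q + r) \<le> real p powi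
          max (int (?v (b * d)) - int (?v (a * d))) (int (?v (b * d)) - int (?v (c * b)))"
        unfolding sum using padic_abs_frac[OF p nz, of "b * d"] q r p prime_ge_1_nat[OF p]
        by (auto intro!: power_int_increasing)
      also have "\<dots> \<le> max (padic_abs p q) (padic_abs p r)"
        using padic_abs_frac[OF p, of "a * d" "b * d"] padic_abs_frac[OF p, of "c * b" "b * d"] q r
        unfolding q'[symmetric] r'[symmetric] by (auto simp: max_def)
      finally show ?thesis .
    qed
  qed simp
qed simp

text \<open>
  A copy of the rational numbers, tagged with \<open>'p\<close> so that it can carry the \<open>p\<close>-adic
  instead of the Euclidean metric.
\<close>

typedef 'p padic_rat = "UNIV :: rat set"
  morphisms rat_of_padic_rat padic_rat_of_rat ..

setup_lifting type_definition_padic_rat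

instantiation padic_rat :: (type) field
begin

lift_definition zero_padic_rat :: "'a padic_rat" is 0 .
lift_definition one_padic_rat :: "'a padic_rat" is 1 .
lift_definition plus_padic_rat :: "'a padic_rat \<Rightarrow> 'a padic_rat \<Rightarrow> 'a padic_rat" is "(+)" .
lift_definition minus_padic_rat :: "'a padic_rat \<Rightarrow> 'a padic_rat \<Rightarrow> 'a padic_rat" is "(-)" .
lift_definition uminus_padic_rat :: "'a padic_rat \<Rightarrow> 'a padic_rat" is "uminus" .
lift_definition times_padic_rat :: "'a padic_rat \<Rightarrow> 'a padic_rat \<Rightarrow> 'a padic_rat" is "(*)" .
lift_definition inverse_padic_rat :: "'a padic_rat \<Rightarrow> 'a padic_rat" is "inverse" .
lift_definition divide_padic_rat :: "'a padic_rat \<Rightarrow> 'a padic_rat \<Rightarrow> 'a padic_rat" is "(div)" .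

instance
  by (standard; transfer; simp add: algebra_simps Fields.field_class.field_divide_inverse)

end

lemma rat_of_padic_rat_of_nat: "rat_of_padic_rat (of_nat n) = of_nat n"
  by (induction n) (simp_all add: zero_padic_rat.rep_eq one_padic_rat.rep_eq plus_padic_rat.rep_eq)

instance padic_rat :: (type) field_char_0
proof
  show "inj (of_nat :: nat \<Rightarrow> 'a padic_rat)"
    by (rule injI) (metis rat_of_padic_rat_of_nat of_nat_eq_iff)
qed

instantiation padic_rat :: (prime_card) valued_field
begin

lift_definition vabs_padic_rat :: "'a padic_rat \<Rightarrow> real" is "padic_abs CARD('a)" .

definition "dist x y = vabs (x - y)" for x y :: "'a padic_rat"

definition [code del]:
  "(uniformity :: ('a padic_rat \<times> 'a padic_rat) filter)
     = (INF e\<in>{0 <..}. principal {(x, y). dist x y < e})"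

definition [code del]:
  "open (U :: 'a padic_rat set)
     \<longleftrightarrow> (\<forall>x\<in>U. \<forall>\<^sub>F (x', y) in uniformity. x' = x \<longrightarrow> y \<in> U)"

instance
proof
  have mult: "vabs (x * y) = vabs x * vabs y"
    and ultra: "vabs (x + y) \<le> max (vabs x) (vabs y)" for x y :: "'a padic_rat"
    by (transfer, rule padic_abs_mult padic_abs_ultra, rule prime_card)+
  have zero: "vabs x = 0 \<longleftrightarrow> x = 0" and nonneg: "0 \<le> vabs x" for x :: "'a padic_rat"
    using padic_abs_pos[OF prime_card[where 'a = 'a]] 
    by (transfer, metis less_irrefl padic_abs_0, transfer, metis less_imp_le order_refl padic_abs_0)
  have "vabs (- 1 :: 'a padic_rat) * vabs (- 1 :: 'a padic_rat) = vabs (1 :: 'a padic_rat)"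
    "vabs (1 :: 'a padic_rat) * vabs (1 :: 'a padic_rat) = vabs (1 :: 'a padic_rat)"
    by (simp_all flip: mult)
  then have "vabs (- 1 :: 'a padic_rat) = 1"
    using nonneg[of "- 1"] zero[of 1] by (auto simp: square_eq_1_iff)
  then have minus: "vabs (- x) = vabs x" for x :: "'a padic_rat"
    using mult[of "- 1" x] by simp
  fix x y z :: "'a padic_rat"
  show "dist x y = vabs (x - y)"
    by (simp add: dist_padic_rat_def)
  show "vabs (x * y) = vabs x * vabs y"
    by (rule mult)
  show "vabs (x + y) \<le> max (vabs x) (vabs y)"
    by (rule ultra)
  show "dist x y = 0 \<longleftrightarrow> x = y"
    by (simp add: dist_padic_rat_def zero)
  show "dist x y \<le> dist x z + dist y z"
    using ultra[of "x - z" "z - y"] minus[of "y - z"] nonneg[of "x - z"] nonneg[of "y - z"]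
    by (simp add: dist_padic_rat_def)
qed (simp_all only: uniformity_padic_rat_def open_padic_rat_def)

end

type_synonym 'p padic = "'p padic_rat vcompletion"

type_synonym 'p complex_padic = "'p padic alg_closure vcompletion"

definition complex_padic_of_padic :: "'p::prime_card padic \<Rightarrow> 'p complex_padic" where
  "complex_padic_of_padic x = to_vcompletion (to_ac x)"

lemma vabs_complex_padic_of_padic [simp]: "vabs (complex_padic_of_padic x) = vabs x"
  by (simp add: complex_padic_of_padic_def)

definition padic_ints :: "'p::prime_card padic set" where
  "padic_ints = {x. vabs x \<le> 1}"

definition padic_int_units :: "'p::prime_card padic set" where
  "padic_int_units = {x. vabs x = 1}"


section \<open>The $p$-adic Gamma function and Mahler series\<close>

definition is_padic_Gamma :: "('p::prime_card padic \<Rightarrow> 'p padic) \<Rightarrow> bool" where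
  "is_padic_Gamma G \<longleftrightarrow>
     G \<in> padic_ints \<rightarrow> padic_int_units \<and>
     continuous_on padic_ints G \<and>
     G 0 = 1 \<and>
     (\<forall>x\<in>padic_ints. vabs x = 1 \<longrightarrow> G (x + 1) = - x * G x) \<and>
     (\<forall>x\<in>padic_ints. vabs x < 1 \<longrightarrow> G (x + 1) = - G x)"

text \<open>
  Requiring the function to be \<open>extensional\<close> fixes its irrelevant values outside $\mathbb{Z}_p$.
\<close>

definition padic_Gamma :: "'p::prime_card padic \<Rightarrow> 'p padic" where
  "padic_Gamma = (THE G. is_padic_Gamma G \<and> G \<in> extensional padic_ints)"

definition falling_factorial :: "'a::comm_ring_1 \<Rightarrow> nat \<Rightarrow> 'a" where
  "falling_factorial x n = (\<Prod>i<n. x - of_nat i)"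

definition mahler_term :: "'p::prime_card complex_padic fps \<Rightarrow> 'p padic \<Rightarrow> nat \<Rightarrow> 'p complex_padic"
  where "mahler_term g x i =
    fps_nth g i * (- 1) ^ i * complex_padic_of_padic (falling_factorial x i)"

definition mahler_series :: "'p::prime_card complex_padic fps \<Rightarrow> 'p padic \<Rightarrow> 'p complex_padic"
  where "mahler_series g x = (\<Sum>i. mahler_term g x i)"

end

theory Submission
  imports
    Defs
    "HOL-Analysis.Uniform_Limit"
    "HOL-Number_Theory.Residue_Primitive_Roots"
begin

text \<open>
  Let $g(n) = \Gamma_p(n)$ if $p \mid n$ and $g(n) = 0$ otherwise, for natural numbers $n$. The equation
  $f' = (1 + X^{p-1}) f$ gives $f = \exp(X) \exp(X^p/p)$, and comparing coefficients shows that
  $(-1)^i i!\, a_i = (\Delta^i g)(0)$; so $[f]$ is Newton's interpolation series of $g$. By Wilson's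
  theorem modulo $p^s$, both $\Gamma_p$ and $g$ are uniformly continuous on the natural numbers for the
  $p$-adic metric, so by Mahler's theorem their interpolation series converge to continuous functions
  on $\mathbb{Z}_p$. This constructs $\Gamma_p$, and the value of $[f]$ follows by density.
\<close>

section \<open>Ultrametric series\<close>

text \<open>The choice of g comes from exp(X^p/p). For k = p m, deleting the multiples of p from k!
  removes exactly p^m m!, so \<Gamma>_p(k) = (-1)^k k!/(p^m m!), and the coefficient 1/(p^m m!) of
  X^k is (-1)^k \<Gamma>_p(k)/k!. Multiplying by exp(X) is a binomial convolution of such
  coefficients, and the sign (-1)^i in the Mahler series turns it into an i-th difference at 0. All
  values on the natural numbers are integers. Uniform continuity thus reduces to divisibility in Z,
  convergence is settled in Q_p, and C_p enters only through an isometric embedding. Setting g to 0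
  off the multiples of p does no harm, since a shift by p^s with s > 0 does not affect divisibility
  by p. Oddness of p makes the sign come out right: the -1 of Wilson's theorem cancels against
  (-1)^(p^s), so that p^s is a period of \<Gamma>_p modulo p^s and not merely a period up to sign.
  As \<open>padic_Gamma\<close> is a definite description, existence and uniqueness must be shown
  before any of its values is known.\<close>

lemma vabs_add_leI:
  fixes x y :: "'a :: valued_field"
  shows "vabs x \<le> C \<Longrightarrow> vabs y \<le> C \<Longrightarrow> vabs (x + y) \<le> C"
  using vabs_ultra[of x y] by simp

lemma vabs_diff_leI:
  fixes x y :: "'a :: valued_field"
  shows "vabs x \<le> C \<Longrightarrow> vabs y \<le> C \<Longrightarrow> vabs (x - y) \<le> C"
  using vabs_ultra_diff[of x y] by simp

lemma vabs_sum_le: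
  fixes f :: "'b \<Rightarrow> 'a :: valued_field"
  assumes "\<And>i. i \<in> A \<Longrightarrow> vabs (f i) \<le> C" and "0 \<le> C"
  shows "vabs (sum f A) \<le> C"
  using assms
proof (induction A rule: infinite_finite_induct)
  case (insert i A)
  then show ?case
    by (simp add: vabs_add_leI)
qed simp_all

lemma vabs_of_nat_le_1 [simp]: "vabs (of_nat n :: 'a :: valued_field) \<le> 1"
proof (induction n)
  case (Suc n)
  then show ?case
    using vabs_ultra[of 1 "of_nat n :: 'a"] by simp
qed simp

lemma vabs_of_int_le_1 [simp]: "vabs (of_int k :: 'a :: valued_field) \<le> 1"
  by (cases k rule: int_cases2) simp_all

lemma vabs_neg_one_power [simp]: "vabs ((- 1) ^ n :: 'a :: valued_field) = 1"
  by (simp add: vabs_power)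

lemma vabs_of_int_dvd_le:
  assumes "a dvd b"
  shows "vabs (of_int b :: 'a :: valued_field) \<le> vabs (of_int a :: 'a)"
proof -
  obtain c where "b = a * c"
    using assms by blast
  then show ?thesis
    using mult_left_mono[OF vabs_of_int_le_1[of c, where 'a = 'a], of "vabs (of_int a :: 'a)"]
    by (simp add: vabs_mult)
qed

lemma vabs_of_nat_dvd_le:
  assumes "a dvd b"
  shows "vabs (of_nat b :: 'a :: valued_field) \<le> vabs (of_nat a :: 'a)"
  using vabs_of_int_dvd_le[of "int a" "int b", where 'a = 'a] assms by simp

lemma vabs_closed_le:
  fixes l :: "'a :: valued_field"
  assumes "s \<longlonglongrightarrow> l" and "\<And>n. n \<ge> N \<Longrightarrow> vabs (s n) \<le> C"
  shows "vabs l \<le> C"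
  using assms(2) by (intro LIMSEQ_le_const2[OF tendsto_vabs[OF assms(1)]]) auto

lemma vabs_sum_tail_le:
  fixes f :: "nat \<Rightarrow> 'a :: valued_field"
  assumes "\<And>i. i \<ge> N \<Longrightarrow> vabs (f i) \<le> C" and "0 \<le> C" and "N \<le> m" and "N \<le> n"
  shows "vabs (sum f {..<m} - sum f {..<n}) \<le> C"
proof -
  have *: "vabs (sum f {..<k} - sum f {..<N}) \<le> C" if "N \<le> k" for k
  proof -
    have "sum f {..<k} - sum f {..<N} = sum f {N..<k}"
      using sum_diff_nat_ivl[of 0 N k f] that by (simp add: atLeast0LessThan)
    then show ?thesis
      using assms(1,2) by (auto intro: vabs_sum_le)
  qed
  have "sum f {..<m} - sum f {..<n}
      = (sum f {..<m} - sum f {..<N}) - (sum f {..<n} - sum f {..<N})"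
    by simp
  then show ?thesis
    using vabs_diff_leI[OF *[OF assms(3)] *[OF assms(4)]] by simp
qed

text \<open>By the ultrametric inequality a block of terms is no larger than its largest term, so
  terms tending to 0 already make the partial sums Cauchy.\<close>

lemma summable_ultrametric:
  fixes f :: "nat \<Rightarrow> 'a :: {valued_field, complete_space}"
  assumes "f \<longlonglongrightarrow> 0"
  shows "summable f"
proof -
  have "Cauchy (\<lambda>n. sum f {..<n})"
    unfolding Cauchy_vabs_iff
  proof (intro allI impI)
    fix e :: real
    assume "0 < e"
    then have "\<forall>\<^sub>F n in sequentially. vabs (f n) < e / 2"
      using assms unfolding tendsto_vabs_iff by (intro order_tendstoD) auto
    then obtain N where "\<And>n. n \<ge> N \<Longrightarrow> vabs (f n) < e / 2"
      unfolding eventually_sequentially by blast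
    then have "\<forall>m\<ge>N. \<forall>n\<ge>N. vabs (sum f {..<m} - sum f {..<n}) \<le> e / 2"
      using \<open>0 < e\<close> by (intro allI impI vabs_sum_tail_le[of N f]) (auto intro: less_imp_le)
    then show "\<exists>M. \<forall>m\<ge>M. \<forall>n\<ge>M. vabs (sum f {..<m} - sum f {..<n}) < e"
      using \<open>0 < e\<close> by (intro exI[of _ N]) fastforce
  qed
  then show ?thesis
    by (simp add: summable_iff_convergent Cauchy_convergent_iff)
qed


section \<open>Mahler's theorem\<close>

definition fdiff :: "(nat \<Rightarrow> 'a :: ab_group_add) \<Rightarrow> nat \<Rightarrow> 'a" where
  "fdiff g n = g (Suc n) - g n"

lemma fdiff_funpow_Suc:
  "(fdiff ^^ Suc i) g n = (fdiff ^^ i) g (Suc n) - (fdiff ^^ i) g n"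
  by (simp add: fdiff_def[of "(fdiff ^^ i) g"])

text \<open>Pascal's rule, arranged as (1 + S)^(n+1) = (1 + S)^n (1 + S) for the shift S of
  sequences. It drives both inductions below.\<close>

lemma sum_choose_Suc:
  fixes a :: "nat \<Rightarrow> 'a :: comm_ring_1"
  shows "(\<Sum>k\<le>Suc n. of_nat (Suc n choose k) * a k)
       = (\<Sum>k\<le>n. of_nat (n choose k) * (a k + a (Suc k)))"
proof -
  have "(\<Sum>k\<le>Suc n. of_nat (Suc n choose k) * a k)
      = a 0 + (\<Sum>k\<le>n. of_nat (n choose Suc k) * a (Suc k)) + (\<Sum>k\<le>n. of_nat (n choose k) * a (Suc k))"
    by (simp add: sum.atMost_Suc_shift ring_distribs sum.distrib del: sum.atMost_Suc)
  also have "a 0 + (\<Sum>k\<le>n. of_nat (n choose Suc k) * a (Suc k)) = (\<Sum>k\<le>Suc n. of_nat (n choose k) * a k)"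
    by (simp add: sum.atMost_Suc_shift del: sum.atMost_Suc)
  also have "\<dots> = (\<Sum>k\<le>n. of_nat (n choose k) * a k)"
    by (simp add: binomial_eq_0)
  finally show ?thesis
    by (simp add: ring_distribs sum.distrib)
qed

text \<open>Expansion of (S - 1)^i for the shift S. The exponent i + k has the parity of i - k and
  avoids truncated subtraction.\<close>

lemma fdiff_funpow_eq_sum:
  fixes g :: "nat \<Rightarrow> 'a :: comm_ring_1"
  shows "(fdiff ^^ i) g n = (\<Sum>k\<le>i. of_nat (i choose k) * ((- 1) ^ (i + k) * g (n + k)))"
proof (induction i arbitrary: n)
  case (Suc i)
  show ?case
    unfolding sum_choose_Suc fdiff_funpow_Suc Suc
    by (simp add: algebra_simps flip: sum_subtractf)
qed simp

text \<open>Expansion of S^n = (1 + \<Delta>)^n, evaluated at 0. The induction passes from g to its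
  shift, with which \<Delta> commutes.\<close>

lemma newton_forward_difference:
  fixes g :: "nat \<Rightarrow> 'a :: comm_ring_1"
  shows "g n = (\<Sum>i\<le>n. of_nat (n choose i) * (fdiff ^^ i) g 0)"
proof (induction n arbitrary: g)
  case (Suc n)
  have *: "(fdiff ^^ i) (\<lambda>n. g (Suc n)) m = (fdiff ^^ i) g (Suc m)" for i m
    by (simp add: fdiff_funpow_eq_sum)
  show ?case
    unfolding sum_choose_Suc using Suc[of "\<lambda>n. g (Suc n)"] by (simp only: * fdiff_funpow_Suc) simp
qed simp

section \<open>Decay of the iterated differences of a uniformly continuous function\<close>

lemma vabs_fdiff_funpow_le:
  fixes g :: "nat \<Rightarrow> 'a :: valued_field"
  assumes "\<And>n. vabs (g n) \<le> C"
  shows "vabs ((fdiff ^^ i) g n) \<le> C"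
proof (induction i arbitrary: n)
  case (Suc i)
  show ?case
    unfolding fdiff_funpow_Suc by (intro vabs_diff_leI Suc)
qed (use assms in simp)

text \<open>From k C(p^s, k) = p^s C(p^s - 1, k - 1): if p did not divide the binomial coefficient,
  all of p^s would have to divide k < p^s.\<close>

lemma prime_dvd_choose_prime_power:
  fixes p :: nat
  assumes "prime p" and "0 < k" and "k < p ^ s"
  shows "p dvd (p ^ s choose k)"
proof (rule ccontr)
  assume "\<not> p dvd (p ^ s choose k)"
  then have "coprime (p ^ s) (p ^ s choose k)"
    using assms(1) by (simp add: prime_imp_coprime)
  moreover have "p ^ s dvd k * (p ^ s choose k)"
    using times_binomial_minus1_eq[of k "p ^ s"] assms by simp
  ultimately have "p ^ s dvd k"
    by (simp add: coprime_dvd_mult_left_iff)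
  then show False
    using assms by (auto dest: dvd_imp_le)
qed

text \<open>Uniform continuity for the p-adic metric on the natural numbers: by the ultrametric
  inequality, a bound for the single shift p^s extends to all pairs congruent modulo p^s.\<close>

definition padic_uniform :: "nat \<Rightarrow> (nat \<Rightarrow> 'a :: valued_field) \<Rightarrow> bool" where
  "padic_uniform p g \<longleftrightarrow> (\<forall>e>0. \<exists>s>0. \<forall>n. vabs (g (n + p ^ s) - g n) \<le> e)"

text \<open>Differences commute with translation and do not increase a uniform bound, so the same s
  serves.\<close>

lemma padic_uniform_fdiff_funpow:
  assumes "padic_uniform p g"
  shows "padic_uniform p ((fdiff ^^ i) g)"
  unfolding padic_uniform_def
proof (intro allI impI)
  fix e :: real
  assume "0 < e"
  then obtain s where "s > 0" and s: "\<And>n. vabs (g (n + p ^ s) - g n) \<le> e"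
    using assms unfolding padic_uniform_def by blast
  have "(fdiff ^^ i) g (n + p ^ s) - (fdiff ^^ i) g n
      = (fdiff ^^ i) (\<lambda>n. g (n + p ^ s) - g n) n" for n
    by (simp add: fdiff_funpow_eq_sum ring_distribs sum_subtractf add_ac)
  then show "\<exists>s>0. \<forall>n. vabs ((fdiff ^^ i) g (n + p ^ s) - (fdiff ^^ i) g n) \<le> e"
    using vabs_fdiff_funpow_le[of "\<lambda>n. g (n + p ^ s) - g n" e] s \<open>s > 0\<close> by auto
qed

text \<open>In the binomial expansion of \<Delta>^(p^s) all inner coefficients are divisible by p,
  and the two outer terms nearly form the increment g(n + p^s) - g(n), which is small by hypothesis.
  So a high difference gains a factor |p|.\<close>

lemma fdiff_prime_power_contraction:
  fixes g :: "nat \<Rightarrow> 'a :: valued_field"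
  assumes p: "prime p" and small: "0 < vabs (of_nat p :: 'a)"
    and u: "padic_uniform p g" and C: "C > 0" "\<And>n. vabs (g n) \<le> C"
  shows "\<exists>s. \<forall>n. vabs ((fdiff ^^ (p ^ s)) g n) \<le> C * vabs (of_nat p :: 'a)"
proof -
  let ?e = "C * vabs (of_nat p :: 'a)"
  have e: "0 < ?e"
    using C small by simp
  then obtain s where "s > 0" and s: "\<And>n. vabs (g (n + p ^ s) - g n) \<le> ?e"
    using u unfolding padic_uniform_def by blast
  have "vabs ((fdiff ^^ (p ^ s)) g n) \<le> ?e" for n
  proof -
    define t where "t k = (of_nat (p ^ s choose k) * ((- 1) ^ (p ^ s + k) * g (n + k)) :: 'a)" for k
    have pos: "0 < p ^ s"
      using p by (simp add: prime_gt_0_nat)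
    have "{..p ^ s} = insert 0 (insert (p ^ s) {0<..<p ^ s})"
      using pos by auto
    then have "(fdiff ^^ (p ^ s)) g n = t 0 + t (p ^ s) + sum t {0<..<p ^ s}"
      using pos unfolding fdiff_funpow_eq_sum t_def[symmetric] by simp
    also have "t 0 + t (p ^ s) = (g (n + p ^ s) - g n) + (1 + (- 1) ^ p ^ s) * g n"
      by (simp add: t_def algebra_simps)
    finally have eq: "(fdiff ^^ (p ^ s)) g n =
        (g (n + p ^ s) - g n) + ((1 + (- 1) ^ p ^ s) * g n + sum t {0<..<p ^ s})"
      by (simp add: algebra_simps)
    \<comment> \<open>The error in treating the outer terms as an increment: 0 for odd p, and 2 = p
      for p = 2.\<close>
    have "vabs (1 + (- 1) ^ p ^ s :: 'a) \<le> vabs (of_nat p :: 'a)"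
    proof (cases "p = 2")
      case True
      then show ?thesis
        using \<open>s > 0\<close> by simp
    next
      case False
      then have "odd p"
        using p prime_odd_nat prime_ge_2_nat[OF p] by force
      then show ?thesis
        by simp
    qed
    then have "vabs ((1 + (- 1) ^ p ^ s) * g n) \<le> ?e"
      unfolding vabs_mult mult.commute[of C] using C by (intro mult_mono) auto
    moreover have "vabs (t k) \<le> ?e" if "k \<in> {0<..<p ^ s}" for k
    proof -
      have "vabs (of_nat (p ^ s choose k) :: 'a) \<le> vabs (of_nat p :: 'a)"
        using that by (intro vabs_of_nat_dvd_le prime_dvd_choose_prime_power p) auto
      then show ?thesis
        unfolding t_def vabs_mult mult.commute[of C] using C by (intro mult_mono) auto
    qed
    then have "vabs (sum t {0<..<p ^ s}) \<le> ?e"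
      using e by (intro vabs_sum_le) auto
    ultimately show ?thesis
      unfolding eq using s[of n] by (intro vabs_add_leI)
  qed
  then show ?thesis
    by blast
qed

text \<open>Iteration of the contraction. Each round replaces g by \<Delta>^(p^s) g and C by C|p|,
  with an s that depends on the round; hence both g and C are generalised in the induction.\<close>

lemma fdiff_funpow_small:
  fixes g :: "nat \<Rightarrow> 'a :: valued_field"
  assumes p: "prime p" and u: "padic_uniform p g" and C: "C > 0" "\<And>n. vabs (g n) \<le> C"
  shows "\<exists>N. \<forall>i\<ge>N. \<forall>n. vabs ((fdiff ^^ i) g n) \<le> C * vabs (of_nat p :: 'a) ^ t"
  using u C
proof (induction t arbitrary: g C)
  case 0
  then show ?case
    using vabs_fdiff_funpow_le[of g C] by auto
next
  case (Suc t)
  let ?q = "vabs (of_nat p :: 'a)"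
  have q: "0 < ?q"
    using p by auto
  obtain s where s: "\<And>n. vabs ((fdiff ^^ (p ^ s)) g n) \<le> C * ?q"
    using fdiff_prime_power_contraction[OF p q Suc.prems] by blast
  obtain N where N: "\<And>i n. i \<ge> N \<Longrightarrow>
      vabs ((fdiff ^^ i) ((fdiff ^^ (p ^ s)) g) n) \<le> C * ?q * ?q ^ t"
    using Suc.IH[OF padic_uniform_fdiff_funpow[OF Suc.prems(1)], of "C * ?q", OF _ s]
      q Suc.prems(2) by auto
  have "vabs ((fdiff ^^ i) g n) \<le> C * ?q ^ Suc t" if "i \<ge> N + p ^ s" for i n
  proof -
    have "(fdiff ^^ i) g = (fdiff ^^ (i - p ^ s)) ((fdiff ^^ (p ^ s)) g)"
      using funpow_add[of "i - p ^ s" "p ^ s" "fdiff :: (nat \<Rightarrow> 'a) \<Rightarrow> _"] that by simp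
    then show ?thesis
      using N[of "i - p ^ s" n] that by (simp add: mult_ac)
  qed
  then show ?case
    by blast
qed

lemma mahler_coeffs_tendsto_0:
  fixes g :: "nat \<Rightarrow> 'a :: valued_field"
  assumes p: "prime p" and small: "vabs (of_nat p :: 'a) < 1"
    and u: "padic_uniform p g" and C: "\<And>n. vabs (g n) \<le> C"
  shows "(\<lambda>i. (fdiff ^^ i) g 0) \<longlonglongrightarrow> 0"
  unfolding tendsto_vabs_iff
proof (rule LIMSEQ_I)
  fix e :: real
  assume "0 < e"
  \<comment> \<open>The contraction argument wants a strictly positive bound, which C need not
    be.\<close>
  have C': "vabs (g n) \<le> max C 1" for n
    using C[of n] by simp
  have "(\<lambda>t. max C 1 * vabs (of_nat p :: 'a) ^ t) \<longlonglongrightarrow> max C 1 * 0"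
    using small by (intro tendsto_mult tendsto_const LIMSEQ_realpow_zero) auto
  then have "\<forall>\<^sub>F t in sequentially. max C 1 * vabs (of_nat p :: 'a) ^ t < e"
    using \<open>0 < e\<close> by (intro order_tendstoD(2)) auto
  then obtain t where t: "max C 1 * vabs (of_nat p :: 'a) ^ t < e"
    unfolding eventually_sequentially by blast
  have "0 < max C 1"
    by simp
  then obtain N where N: "\<And>i. i \<ge> N \<Longrightarrow> vabs ((fdiff ^^ i) g 0) \<le> max C 1 * vabs (of_nat p :: 'a) ^ t"
    using fdiff_funpow_small[OF p u _ C', of t] by auto
  show "\<exists>N. \<forall>i\<ge>N. norm (vabs ((fdiff ^^ i) g 0 - 0) - 0) < e"
    using le_less_trans[OF N t] by (intro exI[of _ N]) simp
qed


section \<open>The Gamma function on the natural numbers\<close>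

text \<open>The unit group modulo p^s is cyclic of even order 2h. The product of all powers of a
  generator g is an odd power of g^h, and g^h is the only element of order 2, namely -1.\<close>

lemma prod_totatives_odd_prime_power:
  assumes "prime p" and "odd p" and "s > 0"
  shows "[int (\<Prod>(totatives (p ^ s))) = - 1] (mod int (p ^ s))"
proof -
  define m where "m = p ^ s"
  obtain g where g: "residue_primroot m g"
    using residue_primroot_odd_prime_power_exists[OF assms(1,2)] assms(3) unfolding m_def by metis
  have p: "p > 2"
    using assms(1,2) prime_ge_2_nat[of p] by (cases "p = 2") auto
  then have m: "m > 2"
    unfolding m_def using self_le_power[of p s] assms(3) by linarith
  then have "even (totient m)"
    by (rule totient_even)
  then obtain h where h: "totient m = 2 * h"
    by (elim evenE)
  have "h > 0"
    using h m totient_gt_0_iff[of m] by simp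
  have sum: "(\<Sum>i<2 * h. i) = h * (2 * h - 1)"
    using gauss_sum_nat[of "2 * h - 1"] \<open>h > 0\<close> by (simp add: lessThan_Suc_atMost[symmetric] atMost_atLeast0[symmetric])
  define a where "a = int g ^ h"
  have "\<Prod>(totatives m) = (\<Prod>i<totient m. g ^ i mod m)"
    using prod.reindex_bij_betw[OF residue_primroot_is_generator[OF _ g], of "\<lambda>x. x"] m by simp
  also have "[\<dots> = (\<Prod>i<totient m. g ^ i)] (mod m)"
    by (intro cong_prod) (simp add: cong_def)
  also have "(\<Prod>i<totient m. g ^ i) = (g ^ h) ^ (2 * h - 1)"
    by (simp add: h sum flip: power_sum power_mult)
  finally have 1: "[int (\<Prod>(totatives m)) = a ^ (2 * h - 1)] (mod int m)"
    unfolding a_def by (simp flip: cong_int_iff)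
  have ord: "ord m g = 2 * h"
    using g h by (simp add: residue_primroot_def)
  have "[g ^ (2 * h) = 1] (mod m)"
    using ord ord_divides[of g "2 * h" m] by simp
  then have "[a ^ 2 = 1] (mod int m)"
    unfolding a_def by (simp add: mult.commute flip: cong_int_iff power_mult)
  then have dvd: "int m dvd (a - 1) * (a + 1)"
    by (simp add: cong_iff_dvd_diff power2_eq_square algebra_simps)
  have "\<not> [g ^ h = 1] (mod m)"
    using ord \<open>h > 0\<close> using ord_divides[of g h m] by (auto dest: dvd_imp_le)
  then have ndvd: "\<not> int m dvd a - 1"
    unfolding a_def by (simp add: cong_iff_dvd_diff flip: cong_int_iff)
  have cop: "coprime (int m) b" if "\<not> int p dvd b" for b
    using that assms(1) by (simp add: m_def prime_imp_coprime)
  \<comment> \<open>p is odd, so it divides at most one of a - 1 and a + 1, and the whole of p^s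
    lies in one factor; that factor is not a - 1, since g^h is not 1.\<close>
  have "int m dvd a + 1"
  proof (cases "int p dvd a - 1")
    case True
    have "\<not> int p dvd a + 1"
    proof
      assume "int p dvd a + 1"
      then have "int p dvd (a + 1) - (a - 1)"
        using True by (rule dvd_diff)
      then show False
        using p by (auto dest: zdvd_imp_le)
    qed
    then show ?thesis
      using dvd ndvd cop by (simp add: coprime_dvd_mult_left_iff)
  next
    case False
    then show ?thesis
      using dvd cop by (simp add: coprime_dvd_mult_right_iff)
  qed
  then have "[a = - 1] (mod int m)"
    by (simp add: cong_iff_dvd_diff)
  then have "[a ^ (2 * h - 1) = (- 1) ^ (2 * h - 1)] (mod int m)"
    by (rule cong_pow)
  then show ?thesis
    using cong_trans[OF 1] \<open>h > 0\<close> by (simp add: m_def)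
qed

section \<open>Morita's product and its period modulo prime powers\<close>

definition morita_factor :: "nat \<Rightarrow> nat \<Rightarrow> int" where
  "morita_factor p n = (if p dvd n then - 1 else - int n)"

text \<open>The value \<Gamma>_p(n), kept as an integer so that congruences modulo p^s can be
  stated.\<close>

definition morita :: "nat \<Rightarrow> nat \<Rightarrow> int" where
  "morita p n = (\<Prod>j<n. morita_factor p j)"

text \<open>For the window starting at 0 the product is (-1)^(p^s) times the product of the units,
  and both are -1 modulo p^s. Moving the window by one step exchanges the factor at n for the
  congruent factor at n + p^s.\<close>

lemma prod_morita_factor_period:
  assumes "odd p" and "prime p" and "s > 0"
  shows "[(\<Prod>j=n..<n + p ^ s. morita_factor p j) = 1] (mod int (p ^ s))"
proof (induction n)
  case 0
  have "p ^ s > 1"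
    using assms(2,3) prime_gt_1_nat by (intro one_less_power)
  have "(\<Prod>j=0..<p ^ s. morita_factor p j) = (\<Prod>j=0..<p ^ s. - (if p dvd j then 1 else int j))"
    by (intro prod.cong) (auto simp: morita_factor_def)
  also have "\<dots> = (- 1) ^ (p ^ s) * (\<Prod>j=0..<p ^ s. if p dvd j then 1 else int j)"
    by (simp add: prod_uminus)
  also have "(\<Prod>j=0..<p ^ s. if p dvd j then 1 else int j) = (\<Prod>j\<in>totatives (p ^ s). int j)"
  proof (rule prod.mono_neutral_cong_right)
    have iff: "coprime j (p ^ s) \<longleftrightarrow> \<not> p dvd j" for j
    proof (cases "p dvd j")
      case True
      moreover have "\<not> is_unit p"
        using assms(2) by auto
      ultimately show ?thesis
        using assms(3) coprime_absorb_right[of p j] by simp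
    next
      case False
      then show ?thesis
        using assms(2) prime_imp_coprime[of p j] by (simp add: coprime_commute)
    qed
    show "totatives (p ^ s) \<subseteq> {0..<p ^ s}"
      using totatives_less[OF _ \<open>p ^ s > 1\<close>] by auto
    show "\<forall>i\<in>{0..<p ^ s} - totatives (p ^ s). (if p dvd i then 1 else int i) = 1"
    proof
      fix i
      assume i: "i \<in> {0..<p ^ s} - totatives (p ^ s)"
      then have "p dvd i"
        using iff[of i] by (cases "i = 0") (auto simp: in_totatives_iff)
      then show "(if p dvd i then 1 else int i) = 1"
        by simp
    qed
    show "(if p dvd j then 1 else int j) = int j" if "j \<in> totatives (p ^ s)" for j
      using that iff by (simp add: in_totatives_iff)
  qed simp
  finally show ?case
    using cong_scalar_left[OF prod_totatives_odd_prime_power[OF assms(2,1,3)], of "- 1"] assms(1) by simp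
next
  case (Suc n)
  have pos: "0 < p ^ s"
    using assms(2) by (simp add: prime_gt_0_nat)
  then obtain m where m: "p ^ s = Suc m"
    using gr0_implies_Suc by blast
  have "[morita_factor p (n + p ^ s) = morita_factor p n] (mod int (p ^ s))"
    using assms(3) by (auto simp: morita_factor_def cong_iff_dvd_diff dvd_add_left_iff)
  then have "[(\<Prod>j=Suc n..<n + p ^ s. morita_factor p j) * morita_factor p (n + p ^ s)
      = (\<Prod>j=Suc n..<n + p ^ s. morita_factor p j) * morita_factor p n] (mod int (p ^ s))"
    by (rule cong_scalar_left)
  also have "(\<Prod>j=Suc n..<n + p ^ s. morita_factor p j) * morita_factor p (n + p ^ s)
      = (\<Prod>j=Suc n..<Suc n + p ^ s. morita_factor p j)"
    by (simp add: m)
  also have "(\<Prod>j=Suc n..<n + p ^ s. morita_factor p j) * morita_factor p n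
      = (\<Prod>j=n..<n + p ^ s. morita_factor p j)"
    using pos by (simp add: prod.atLeast_Suc_lessThan[of n] mult.commute)
  finally show ?case
    using Suc.IH by (rule cong_trans)
qed

lemma morita_period:
  assumes "odd p" and "prime p" and "s > 0"
  shows "int p ^ s dvd morita p (n + p ^ s) - morita p n"
proof -
  have "morita p (n + p ^ s) = morita p n * (\<Prod>j=n..<n + p ^ s. morita_factor p j)"
    unfolding morita_def using prod.atLeastLessThan_concat[of 0 n "n + p ^ s" "morita_factor p"]
    by (simp add: lessThan_atLeast0)
  then have "[morita p (n + p ^ s) = morita p n * 1] (mod int (p ^ s))"
    using cong_scalar_left[OF prod_morita_factor_period[OF assms]] by metis
  then show ?thesis
    by (simp add: cong_iff_dvd_diff)
qed

lemma morita_Suc: "morita p (Suc n) = morita_factor p n * morita p n"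
  by (simp add: morita_def)

lemma morita_0 [simp]: "morita p 0 = 1"
  by (simp add: morita_def)

text \<open>This is what makes the values p-adic units.\<close>

lemma not_dvd_morita:
  assumes "prime p"
  shows "\<not> int p dvd morita p n"
proof (induction n)
  case 0
  then show ?case
    using assms by auto
next
  case (Suc n)
  have "\<not> int p dvd morita_factor p n"
    using assms by (auto simp: morita_factor_def)
  then show ?case
    using Suc assms by (simp add: morita_Suc prime_dvd_mult_iff)
qed

definition morita_multiples :: "nat \<Rightarrow> nat \<Rightarrow> int" where
  "morita_multiples p n = (if p dvd n then morita p n else 0)"


section \<open>The $p$-adic integers\<close>

text \<open>With k u + p v = 1, the ultrametric inequality forces |k u| to reach 1, because |p v| <
  1.\<close>

lemma vabs_of_int_eq_1:
  assumes "prime p" and "vabs (of_nat p :: 'a :: valued_field) < 1" and "\<not> int p dvd k"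
  shows "vabs (of_int k :: 'a) = 1"
proof -
  have "coprime (int p) k"
    using assms(1,3) by (simp add: prime_imp_coprime)
  then obtain u v where "k * u + int p * v = 1"
    using bezout_int[of "int p" k] by (auto simp: algebra_simps)
  then have "of_int (k * u + int p * v) = (1 :: 'a)"
    by simp
  then have "1 \<le> max (vabs (of_int (k * u) :: 'a)) (vabs (of_int (int p * v) :: 'a))"
    using vabs_ultra[of "of_int (k * u) :: 'a" "of_int (int p * v)"] by (metis of_int_add vabs_1)
  moreover have "vabs (of_int (int p * v) :: 'a) < 1"
    using vabs_of_int_dvd_le[of "int p" "int p * v", where 'a = 'a] assms(2) by simp
  moreover have "vabs (of_int (k * u) :: 'a) \<le> vabs (of_int k :: 'a)"
    by (rule vabs_of_int_dvd_le) simp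
  ultimately show ?thesis
    using vabs_of_int_le_1[of k, where 'a = 'a] by linarith
qed

lemma vabs_padic_prime: "vabs (of_nat CARD('p) :: 'p::prime_card padic) = 1 / real CARD('p)"
proof -
  have p: "prime CARD('p)"
    by (rule prime_card)
  have "vabs (of_nat CARD('p) :: 'p padic) = vabs (of_nat CARD('p) :: 'p padic_rat)"
    by (simp flip: to_vcompletion_of_nat)
  also have "\<dots> = padic_abs CARD('p) (of_int (int CARD('p)) / of_int 1)"
    by (simp add: vabs_padic_rat.rep_eq rat_of_padic_rat_of_nat)
  also have "\<dots> = 1 / real CARD('p)"
    by (subst padic_abs_frac[OF p]) (use p in \<open>auto simp: power_int_minus field_simps\<close>)
  finally show ?thesis .
qed

lemma vabs_padic_prime_less_1: "vabs (of_nat CARD('p) :: 'p::prime_card padic) < 1"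
  using prime_gt_1_nat[OF prime_card[where 'a = 'p]] by (simp add: vabs_padic_prime)

lemma vabs_padic_of_int_less_1_iff:
  "vabs (of_int k :: 'p::prime_card padic) < 1 \<longleftrightarrow> int CARD('p) dvd k"
proof
  show "vabs (of_int k :: 'p padic) < 1 \<Longrightarrow> int CARD('p) dvd k"
    using vabs_of_int_eq_1[OF prime_card vabs_padic_prime_less_1] by force
  show "int CARD('p) dvd k \<Longrightarrow> vabs (of_int k :: 'p padic) < 1"
    using vabs_of_int_dvd_le[of "int CARD('p)" k, where 'a = "'p padic"] vabs_padic_prime_less_1[where 'p = 'p]
    by simp
qed

lemma vabs_padic_of_nat_less_1_iff:
  "vabs (of_nat n :: 'p::prime_card padic) < 1 \<longleftrightarrow> CARD('p) dvd n"
  using vabs_padic_of_int_less_1_iff[of "int n", where 'p = 'p] by simp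

lemma exists_vabs_padic_prime_power_less:
  assumes "0 < (e :: real)"
  shows "\<exists>s>0. vabs (of_nat CARD('p) :: 'p::prime_card padic) ^ s < e"
proof -
  have "(\<lambda>s. vabs (of_nat CARD('p) :: 'p padic) ^ s) \<longlonglongrightarrow> 0"
    using vabs_padic_prime_less_1[where 'p = 'p] by (intro LIMSEQ_realpow_zero) auto
  then have "\<forall>\<^sub>F s in sequentially. vabs (of_nat CARD('p) :: 'p padic) ^ s < e"
    using assms by (rule order_tendstoD(2))
  then show ?thesis
    using eventually_gt_at_top[of 0] eventually_happens'[OF sequentially_bot eventually_conj] by blast
qed

section \<open>Density of the natural numbers in the p-adic integers\<close>

lemma to_vcompletion_of_int [simp]: "to_vcompletion (of_int k) = of_int k"
  by (cases k rule: int_cases2) (simp_all add: to_vcompletion_minus)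

lemma rat_of_padic_rat_of_int: "rat_of_padic_rat (of_int k) = of_int k"
  by (cases k rule: int_cases2) (simp_all add: rat_of_padic_rat_of_nat uminus_padic_rat.rep_eq)

lemma padic_nat_dense:
  fixes x :: "'p::prime_card padic"
  assumes "x \<in> padic_ints" and "0 < e"
  shows "\<exists>n. vabs (x - of_nat n) < e"
proof -
  let ?p = "CARD('p)"
  have p: "prime (int ?p)"
    using prime_card[where 'a = 'p] by simp
  \<comment> \<open>The bound 1 in the minimum keeps the rational approximation inside the unit
    ball.\<close>
  obtain c :: "'p padic_rat" where c: "vabs (x - to_vcompletion c) < min e 1"
    using to_vcompletion_dense[of "min e 1" x] \<open>0 < e\<close> by auto
  define y where "y = to_vcompletion c"
  have y: "vabs y \<le> 1"
    using vabs_diff_leI[of x 1 "x - y"] c assms(1) by (simp add: y_def padic_ints_def)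
  obtain a b where ab: "quotient_of (rat_of_padic_rat c) = (a, b)"
    by fastforce
  then have "coprime a b" "b > 0"
    by (simp_all add: quotient_of_coprime quotient_of_denom_pos)
  have "rat_of_padic_rat (c * of_int b) = rat_of_padic_rat (of_int a)"
    using quotient_of_div[OF ab] \<open>b > 0\<close> by (simp add: times_padic_rat.rep_eq rat_of_padic_rat_of_int)
  then have "c * of_int b = of_int a"
    by (rule iffD1[OF rat_of_padic_rat_inject])
  then have yb: "y * of_int b = of_int a"
    unfolding y_def by (metis to_vcompletion_mult to_vcompletion_of_int)
  \<comment> \<open>Since |a| = |y||b| and |y| \<le> 1, a factor p of the denominator would also
    divide the numerator.\<close>
  have b: "\<not> int ?p dvd b"
  proof
    assume dvd: "int ?p dvd b"
    then have "vabs (of_int b :: 'p padic) < 1"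
      by (simp add: vabs_padic_of_int_less_1_iff)
    then have "vabs (of_int a :: 'p padic) < 1"
      using y mult_left_le_one_le[of "vabs (of_int b :: 'p padic)" "vabs y"] by (simp flip: yb add: vabs_mult)
    then show False
      using dvd \<open>coprime a b\<close> p by (auto simp: vabs_padic_of_int_less_1_iff dest: coprime_common_divisor)
  qed
  obtain s where s: "vabs (of_nat ?p :: 'p padic) ^ s < e"
    using exists_vabs_padic_prime_power_less[OF \<open>0 < e\<close>] by blast
  let ?m = "int ?p ^ s"
  have "coprime b ?m"
    using prime_imp_coprime[OF p b] by (simp add: coprime_commute)
  \<comment> \<open>Inverting the denominator modulo p^s turns a/b into a natural number n with b n
    congruent to a; as |b| = 1, the congruence bounds |y - n|.\<close>
  then obtain d where d: "[b * d = 1] (mod ?m)"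
    using cong_solve_coprime_int by blast
  define n where "n = nat (a * d mod ?m)"
  have "int n = a * d mod ?m"
    using p by (simp add: n_def prime_gt_0_int)
  then have "[b * int n = b * (a * d)] (mod ?m)"
    by (simp add: cong_def mod_mult_right_eq)
  also have "[b * (a * d) = a] (mod ?m)"
    using cong_scalar_left[OF d, of a] by (simp add: mult_ac)
  finally have "?m dvd a - b * int n"
    by (simp add: cong_iff_dvd_diff dvd_diff_commute)
  then have "vabs (of_int (a - b * int n) :: 'p padic) \<le> vabs (of_int ?m :: 'p padic)"
    by (rule vabs_of_int_dvd_le)
  also have "of_int (a - b * int n) = (y - of_nat n) * of_int b"
    by (simp add: yb[symmetric] algebra_simps)
  also have "vabs \<dots> = vabs (y - of_nat n)"
    using vabs_of_int_eq_1[OF prime_card vabs_padic_prime_less_1 b] by (simp add: vabs_mult)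
  also have "vabs (of_int ?m :: 'p padic) < e"
    using s by (simp add: vabs_power)
  finally have "vabs (y - of_nat n) < e" .
  moreover have "vabs (x - of_nat n) \<le> max (vabs (x - y)) (vabs (y - of_nat n))"
    using vabs_ultra[of "x - y" "y - of_nat n"] by simp
  ultimately have "vabs (x - of_nat n) < e"
    using c by (auto simp: y_def)
  then show ?thesis
    by blast
qed

lemma padic_int_limit_of_nats:
  fixes x :: "'p::prime_card padic"
  assumes "x \<in> padic_ints"
  obtains s where "(\<lambda>n. of_nat (s n) :: 'p padic) \<longlonglongrightarrow> x"
proof -
  have "\<forall>n. \<exists>k. vabs (x - of_nat k) < inverse (real (Suc n))"
    using padic_nat_dense[OF assms] by simp
  then obtain s where s: "\<And>n. vabs (x - of_nat (s n)) < inverse (real (Suc n))"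
    by metis
  have "(\<lambda>n. of_nat (s n) :: 'p padic) \<longlonglongrightarrow> x"
    unfolding tendsto_vabs_iff
    by (rule tendsto_0_sandwich[OF always_eventually LIMSEQ_inverse_real_of_nat])
      (use s in \<open>auto simp: vabs_minus_commute[of _ x] intro: less_imp_le\<close>)
  then show ?thesis
    by (rule that)
qed

lemma of_nat_in_padic_ints [simp]: "of_nat n \<in> padic_ints"
  by (simp add: padic_ints_def)

lemma continuous_on_padic_ints_tendsto:
  fixes f :: "'p::prime_card padic \<Rightarrow> 'b :: topological_space"
  assumes "continuous_on padic_ints f" and "s \<longlonglongrightarrow> x" and "x \<in> padic_ints"
    and "\<And>n. s n \<in> padic_ints"
  shows "(\<lambda>n. f (s n)) \<longlonglongrightarrow> f x"
  using continuous_on_tendsto_compose[OF assms(1-3)] assms(4) by simp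

section \<open>Continuity and integrality of binomial coefficients\<close>

lemma tendsto_falling_factorial:
  fixes x :: "'a :: valued_field"
  assumes "(s \<longlongrightarrow> x) F"
  shows "((\<lambda>n. falling_factorial (s n) i) \<longlongrightarrow> falling_factorial x i) F"
proof (induction i)
  case (Suc i)
  then show ?case
    using tendsto_mult[OF Suc tendsto_diff[OF assms tendsto_const]]
    by (simp add: falling_factorial_def)
qed (simp add: falling_factorial_def)

lemma gbinomial_eq_falling_factorial:
  fixes x :: "'a :: field_char_0"
  shows "x gchoose i = falling_factorial x i / fact i"
  by (simp add: gbinomial_prod_rev falling_factorial_def lessThan_atLeast0)

lemma tendsto_gbinomial:
  fixes x :: "'a :: valued_field"
  assumes "(s \<longlongrightarrow> x) F"
  shows "((\<lambda>n. s n gchoose i) \<longlongrightarrow> x gchoose i) F"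
  using tendsto_mult[OF tendsto_falling_factorial[OF assms] tendsto_const[of "inverse (fact i)"]]
  by (simp add: gbinomial_eq_falling_factorial divide_inverse)

text \<open>At natural numbers the value is an integer; density and continuity of the polynomial
  carry the closed bound over to every p-adic integer.\<close>

lemma vabs_gbinomial_padic_int_le_1:
  fixes x :: "'p::prime_card padic"
  assumes "x \<in> padic_ints"
  shows "vabs (x gchoose i) \<le> 1"
proof -
  obtain s where "(\<lambda>n. of_nat (s n) :: 'p padic) \<longlonglongrightarrow> x"
    using padic_int_limit_of_nats[OF assms] .
  then have "(\<lambda>n. (of_nat (s n) :: 'p padic) gchoose i) \<longlonglongrightarrow> x gchoose i"
    by (rule tendsto_gbinomial)
  then show ?thesis
    by (rule vabs_closed_le[of _ _ 0]) (simp flip: binomial_gbinomial)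
qed


section \<open>Mahler extension of a uniformly continuous function\<close>

text \<open>Newton's series in the binomial basis, with values in Q_p;
  \<open>mahler_term_exp\<close> identifies its terms with those of
  \<open>mahler_series\<close>.\<close>

definition mahler_ext :: "(nat \<Rightarrow> 'p::prime_card padic) \<Rightarrow> 'p padic \<Rightarrow> 'p padic" where
  "mahler_ext g x = (\<Sum>i. (fdiff ^^ i) g 0 * (x gchoose i))"

context
  fixes g :: "nat \<Rightarrow> 'p::prime_card padic"
  assumes g: "padic_uniform CARD('p) g" "\<And>n. vabs (g n) \<le> 1"
begin

text \<open>The binomials are bounded by 1, so the bound does not depend on x. Hence it yields both
  convergence at a point and uniform convergence.\<close>

lemma mahler_term_tail_small:
  assumes "0 < e"
  obtains N where "\<And>i x. i \<ge> N \<Longrightarrow> x \<in> padic_ints \<Longrightarrow> vabs ((fdiff ^^ i) g 0 * (x gchoose i)) \<le> e"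
proof -
  have "(\<lambda>i. vabs ((fdiff ^^ i) g 0 - 0)) \<longlonglongrightarrow> 0"
    using mahler_coeffs_tendsto_0[OF prime_card vabs_padic_prime_less_1 g]
    by (subst (asm) tendsto_vabs_iff)
  then have "\<forall>\<^sub>F i in sequentially. vabs ((fdiff ^^ i) g 0 - 0) < e"
    using assms by (rule order_tendstoD(2))
  then obtain N where N: "\<And>i. i \<ge> N \<Longrightarrow> vabs ((fdiff ^^ i) g 0) < e"
    unfolding eventually_sequentially by auto
  have "vabs ((fdiff ^^ i) g 0 * (x gchoose i)) \<le> e * 1" if "i \<ge> N" "x \<in> padic_ints" for i x
    unfolding vabs_mult using N[OF that(1)] vabs_gbinomial_padic_int_le_1[OF that(2)] assms
    by (intro mult_mono) auto
  then show ?thesis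
    using that[of N] by simp
qed

lemma mahler_ext_sums:
  assumes "x \<in> padic_ints"
  shows "(\<lambda>i. (fdiff ^^ i) g 0 * (x gchoose i)) sums mahler_ext g x"
  unfolding mahler_ext_def
proof (intro summable_sums summable_ultrametric)
  show "(\<lambda>i. (fdiff ^^ i) g 0 * (x gchoose i)) \<longlonglongrightarrow> 0"
  proof (rule metric_LIMSEQ_I)
    fix e :: real
    assume "0 < e"
    then obtain N where "\<And>i. i \<ge> N \<Longrightarrow> vabs ((fdiff ^^ i) g 0 * (x gchoose i)) \<le> e / 2"
      using mahler_term_tail_small[of "e / 2"] assms by (metis half_gt_zero)
    then show "\<exists>N. \<forall>i\<ge>N. dist ((fdiff ^^ i) g 0 * (x gchoose i)) 0 < e"
      using \<open>0 < e\<close> by (intro exI[of _ N]) (fastforce simp: dist_vabs)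
  qed
qed

lemma continuous_on_mahler_ext: "continuous_on padic_ints (mahler_ext g)"
proof (rule uniform_limit_theorem)
  let ?S = "\<lambda>N x. \<Sum>i<N. (fdiff ^^ i) g 0 * (x gchoose i)"
  show "\<forall>\<^sub>F N in sequentially. continuous_on padic_ints (?S N)"
    unfolding continuous_on_def
    by (intro always_eventually allI ballI tendsto_sum tendsto_mult tendsto_const tendsto_gbinomial tendsto_ident_at)
  show "uniform_limit padic_ints ?S (mahler_ext g) sequentially"
  proof (rule uniform_limitI)
    fix e :: real
    assume "0 < e"
    then obtain N where N: "\<And>i x. i \<ge> N \<Longrightarrow> x \<in> padic_ints \<Longrightarrow>
        vabs ((fdiff ^^ i) g 0 * (x gchoose i)) \<le> e / 2"
      using mahler_term_tail_small[of "e / 2"] by (metis half_gt_zero)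
    have "vabs (?S n x - mahler_ext g x) \<le> e / 2" if "n \<ge> N" "x \<in> padic_ints" for n x
    \<comment> \<open>The bound on a block between two partial sums survives when the longer sum
      tends to the full series.\<close>
    proof (rule vabs_closed_le)
      show "(\<lambda>m. ?S n x - ?S m x) \<longlonglongrightarrow> ?S n x - mahler_ext g x"
        using mahler_ext_sums[OF that(2)] by (intro tendsto_diff tendsto_const) (simp add: sums_def)
      show "vabs (?S n x - ?S m x) \<le> e / 2" if "m \<ge> N" for m
        using N \<open>0 < e\<close> \<open>n \<ge> N\<close> \<open>x \<in> padic_ints\<close> that by (intro vabs_sum_tail_le[of N]) auto
    qed
    then show "\<forall>\<^sub>F n in sequentially. \<forall>x\<in>padic_ints. dist (?S n x) (mahler_ext g x) < e"
      unfolding eventually_sequentially dist_vabs using \<open>0 < e\<close> by (intro exI[of _ N]) fastforce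
  qed
qed simp

text \<open>At n the binomials with i > n vanish, and what remains is Newton's formula.\<close>

lemma mahler_ext_of_nat: "mahler_ext g (of_nat n) = g n"
proof -
  have "(\<lambda>i. (fdiff ^^ i) g 0 * (of_nat n gchoose i)) sums (\<Sum>i\<le>n. (fdiff ^^ i) g 0 * (of_nat n gchoose i))"
    by (intro sums_finite) (auto simp: binomial_eq_0 simp flip: binomial_gbinomial)
  also have "(\<Sum>i\<le>n. (fdiff ^^ i) g 0 * (of_nat n gchoose i)) = g n"
    by (subst (2) newton_forward_difference) (simp add: mult.commute flip: binomial_gbinomial)
  finally show ?thesis
    using mahler_ext_sums[OF of_nat_in_padic_ints] sums_unique2 by blast
qed

end


section \<open>The $p$-adic Gamma function\<close>

lemma padic_uniform_of_int:
  fixes h :: "nat \<Rightarrow> int"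
  assumes "\<And>s n. s > 0 \<Longrightarrow> int CARD('p) ^ s dvd h (n + CARD('p) ^ s) - h n"
  shows "padic_uniform CARD('p) (\<lambda>n. of_int (h n) :: 'p::prime_card padic)"
  unfolding padic_uniform_def
proof (intro allI impI)
  fix e :: real
  assume "0 < e"
  then obtain s where s: "s > 0" "vabs (of_nat CARD('p) :: 'p padic) ^ s < e"
    using exists_vabs_padic_prime_power_less by blast
  have "vabs (of_int (h (n + CARD('p) ^ s)) - of_int (h n) :: 'p padic) \<le> e" for n
    using vabs_of_int_dvd_le[OF assms[OF s(1), of n], where 'a = "'p padic"] s(2)
    by (simp add: vabs_power)
  then show "\<exists>s>0. \<forall>n. vabs (of_int (h (n + CARD('p) ^ s)) - of_int (h n) :: 'p padic) \<le> e"
    using s(1) by blast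
qed

lemma
  assumes "odd CARD('p::prime_card)"
  shows padic_uniform_morita: "padic_uniform CARD('p) (\<lambda>n. of_int (morita CARD('p) n) :: 'p padic)"
    and padic_uniform_morita_multiples:
      "padic_uniform CARD('p) (\<lambda>n. of_int (morita_multiples CARD('p) n) :: 'p padic)"
proof -
  have *: "int CARD('p) ^ s dvd morita CARD('p) (n + CARD('p) ^ s) - morita CARD('p) n" if "s > 0" for s n
    by (rule morita_period[OF assms prime_card that])
  show "padic_uniform CARD('p) (\<lambda>n. of_int (morita CARD('p) n) :: 'p padic)"
    by (rule padic_uniform_of_int) (rule *)
  show "padic_uniform CARD('p) (\<lambda>n. of_int (morita_multiples CARD('p) n) :: 'p padic)"
  proof (rule padic_uniform_of_int)
    fix s n :: nat
    assume "s > 0"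
    then have "CARD('p) dvd n + CARD('p) ^ s \<longleftrightarrow> CARD('p) dvd n"
      by (simp add: dvd_add_left_iff)
    then show "int CARD('p) ^ s dvd morita_multiples CARD('p) (n + CARD('p) ^ s) - morita_multiples CARD('p) n"
      using *[OF \<open>s > 0\<close>, of n] by (simp add: morita_multiples_def)
  qed
qed

text \<open>The open unit ball is closed as well as open. The case distinction in the functional
  equation is therefore constant near the limit.\<close>

lemma eventually_vabs_less_1_iff:
  fixes x :: "'a :: valued_field"
  assumes "(s \<longlongrightarrow> x) F"
  shows "\<forall>\<^sub>F n in F. vabs (s n) < 1 \<longleftrightarrow> vabs x < 1"
proof -
  have "\<forall>\<^sub>F n in F. vabs (s n - x) < 1"
    using assms unfolding tendsto_vabs_iff by (rule order_tendstoD(2)) simp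
  then show ?thesis
  proof eventually_elim
    case (elim n)
    then show ?case
      using vabs_ultra[of "s n - x" x] vabs_ultra_diff[of "s n" "s n - x"] by auto
  qed
qed

section \<open>The functional equation, existence and uniqueness of the Gamma function\<close>

lemma of_int_morita_factor:
  "of_int (morita_factor CARD('p) n) =
    (if vabs (of_nat n :: 'p::prime_card padic) < 1 then - 1 else - of_nat n :: 'p padic)"
  by (simp add: morita_factor_def vabs_padic_of_nat_less_1_iff)

lemma padic_ints_add_1: "x \<in> padic_ints \<Longrightarrow> x + 1 \<in> padic_ints"
  by (simp add: padic_ints_def vabs_add_leI)

text \<open>On the unit ball |x| = 1 is the negation of |x| < 1, so the two functional equations
  merge into one.\<close>

lemma is_padic_Gamma_iff:
  "is_padic_Gamma (G :: 'p::prime_card padic \<Rightarrow> _) \<longleftrightarrow>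
     G \<in> padic_ints \<rightarrow> padic_int_units \<and> continuous_on padic_ints G \<and> G 0 = 1 \<and>
     (\<forall>x\<in>padic_ints. G (x + 1) = (if vabs x < 1 then - 1 else - x) * G x)"
  unfolding is_padic_Gamma_def by (force simp: padic_ints_def)

lemma is_padic_Gamma_of_nat:
  assumes "is_padic_Gamma (G :: 'p::prime_card padic \<Rightarrow> _)"
  shows "G (of_nat n) = of_int (morita CARD('p) n)"
proof (induction n)
  case (Suc n)
  have "G (of_nat n + 1) = of_int (morita_factor CARD('p) n) * G (of_nat n)"
    using assms of_nat_in_padic_ints[of n] unfolding of_int_morita_factor is_padic_Gamma_iff by blast
  then show ?case
    by (simp add: Suc morita_Suc add.commute)
qed (use assms in \<open>simp add: is_padic_Gamma_def\<close>)

lemma continuous_on_padic_ints_eqI: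
  fixes f g :: "'p::prime_card padic \<Rightarrow> 'b :: t2_space"
  assumes "continuous_on padic_ints f" and "continuous_on padic_ints g"
    and "\<And>n. f (of_nat n) = g (of_nat n)" and "x \<in> padic_ints"
  shows "f x = g x"
proof -
  obtain s where s: "(\<lambda>n. of_nat (s n) :: 'p padic) \<longlonglongrightarrow> x"
    using padic_int_limit_of_nats[OF assms(4)] .
  show ?thesis
    using continuous_on_padic_ints_tendsto[OF assms(1) s assms(4)]
      continuous_on_padic_ints_tendsto[OF assms(2) s assms(4)] LIMSEQ_unique
    by (auto simp: assms(3))
qed

context
  assumes odd: "odd CARD('p::prime_card)"
begin

text \<open>Existence: each required property holds at the natural numbers by the product formula
  and passes to limits by continuity.\<close>

lemma is_padic_Gamma_mahler_ext:
  "is_padic_Gamma (mahler_ext (\<lambda>n. of_int (morita CARD('p) n)) :: 'p padic \<Rightarrow> 'p padic)"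
proof -
  define G :: "'p padic \<Rightarrow> 'p padic" where "G = mahler_ext (\<lambda>n. of_int (morita CARD('p) n))"
  have u: "padic_uniform CARD('p) (\<lambda>n. of_int (morita CARD('p) n) :: 'p padic)"
    using odd by (rule padic_uniform_morita)
  have nat: "G (of_nat n) = of_int (morita CARD('p) n)" for n
    unfolding G_def by (rule mahler_ext_of_nat[OF u]) simp
  have cont: "continuous_on padic_ints G"
    unfolding G_def by (rule continuous_on_mahler_ext[OF u]) simp
  have unit: "G x \<in> padic_int_units" if x: "x \<in> padic_ints" for x
  proof -
    obtain s where s: "(\<lambda>n. of_nat (s n) :: 'p padic) \<longlonglongrightarrow> x"
      using padic_int_limit_of_nats[OF x] .
    have "(\<lambda>n. vabs (G (of_nat (s n)))) \<longlonglongrightarrow> vabs (G x)"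
      by (intro tendsto_vabs continuous_on_padic_ints_tendsto[OF cont s x]) simp
    moreover have "vabs (G (of_nat n)) = 1" for n
      unfolding nat using vabs_of_int_eq_1[OF prime_card vabs_padic_prime_less_1 not_dvd_morita[OF prime_card]] .
    ultimately show ?thesis
      by (simp add: padic_int_units_def LIMSEQ_const_iff)
  qed
  have step: "G (x + 1) = (if vabs x < 1 then - 1 else - x) * G x" if x: "x \<in> padic_ints" for x
  proof -
    obtain s where s: "(\<lambda>n. of_nat (s n) :: 'p padic) \<longlonglongrightarrow> x"
      using padic_int_limit_of_nats[OF x] .
    \<comment> \<open>The branch is selected by the limit x, so the limit is taken within one
      branch; for all large n it is also the branch belonging to \<open>s n\<close>.\<close>
    have "(\<lambda>n. (if vabs x < 1 then - 1 else - of_nat (s n)) * G (of_nat (s n)))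
        \<longlonglongrightarrow> (if vabs x < 1 then - 1 else - x) * G x"
      using s by (intro tendsto_mult continuous_on_padic_ints_tendsto[OF cont s x])
        (auto intro: tendsto_minus)
    moreover have "\<forall>\<^sub>F n in sequentially.
        (if vabs x < 1 then - 1 else - of_nat (s n)) * G (of_nat (s n)) = G (of_nat (s n) + 1)"
      using eventually_vabs_less_1_iff[OF s]
    proof eventually_elim
      case (elim n)
      have "G (of_nat (s n) + 1) = of_int (morita_factor CARD('p) (s n)) * G (of_nat (s n))"
        using nat[of "Suc (s n)"] by (simp add: nat morita_Suc add.commute)
      then show ?case
        using elim by (simp add: of_int_morita_factor)
    qed
    ultimately have "(\<lambda>n. G (of_nat (s n) + 1)) \<longlonglongrightarrow> (if vabs x < 1 then - 1 else - x) * G x"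
      by (rule Lim_transform_eventually)
    moreover have "(\<lambda>n. G (of_nat (s n) + 1)) \<longlonglongrightarrow> G (x + 1)"
    proof (rule continuous_on_padic_ints_tendsto[OF cont])
      show "(\<lambda>n. of_nat (s n) + 1) \<longlonglongrightarrow> x + 1"
        using s by (intro tendsto_add tendsto_const)
      show "x + 1 \<in> padic_ints" "of_nat (s n) + 1 \<in> padic_ints" for n
        using x by (simp_all add: padic_ints_add_1)
    qed
    ultimately show ?thesis
      by (intro LIMSEQ_unique[of _ "G (x + 1)"])
  qed
  have "G 0 = 1"
    using nat[of 0] by simp
  then show ?thesis
    unfolding G_def[symmetric] is_padic_Gamma_iff
    by (intro conjI ballI Pi_I unit cont step)
qed

lemma padic_Gamma_eq_mahler_ext:
  assumes "x \<in> padic_ints"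
  shows "padic_Gamma x = (mahler_ext (\<lambda>n. of_int (morita CARD('p) n)) x :: 'p padic)"
proof -
  define G :: "'p padic \<Rightarrow> 'p padic" where "G = mahler_ext (\<lambda>n. of_int (morita CARD('p) n))"
  have G: "is_padic_Gamma G"
    unfolding G_def by (rule is_padic_Gamma_mahler_ext)
  have unique: "H y = G y" if H: "is_padic_Gamma H" and y: "y \<in> padic_ints" for H and y :: "'p padic"
  proof (rule continuous_on_padic_ints_eqI[OF _ _ _ y])
    show "continuous_on padic_ints H" "continuous_on padic_ints G"
      using H G unfolding is_padic_Gamma_def by blast+
    show "H (of_nat n) = G (of_nat n)" for n
      unfolding is_padic_Gamma_of_nat[OF H] is_padic_Gamma_of_nat[OF G] ..
  qed
  \<comment> \<open>The definite description ranges over extensional functions, so the witness has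
    to be cut off outside the p-adic integers.\<close>
  have "is_padic_Gamma (restrict G padic_ints)"
  proof -
    have "continuous_on padic_ints (restrict G padic_ints) \<longleftrightarrow> continuous_on padic_ints G"
      by (rule continuous_on_cong) simp_all
    moreover have "(0 :: 'p padic) \<in> padic_ints"
      using of_nat_in_padic_ints[of 0] by simp
    ultimately show ?thesis
      using G unfolding is_padic_Gamma_iff by (simp add: Pi_iff padic_ints_add_1)
  qed
  then have "is_padic_Gamma (restrict G padic_ints) \<and> restrict G padic_ints \<in> extensional padic_ints"
    by simp
  then have "is_padic_Gamma (padic_Gamma :: 'p padic \<Rightarrow> 'p padic) \<and> (padic_Gamma :: 'p padic \<Rightarrow> 'p padic) \<in> extensional padic_ints"
    unfolding padic_Gamma_def
  proof (rule theI[where P = "\<lambda>G. is_padic_Gamma G \<and> G \<in> extensional padic_ints"])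
    fix H :: "'p padic \<Rightarrow> 'p padic"
    assume "is_padic_Gamma H \<and> H \<in> extensional padic_ints"
    then show "H = restrict G padic_ints"
      using unique by (intro extensionalityI[of _ padic_ints]) auto
  qed
  then show ?thesis
    using unique assms unfolding G_def by blast
qed

text \<open>Along natural numbers tending to x, divisibility by p eventually agrees with |x| < 1;
  the interpolated values are then those of \<Gamma>_p throughout, or 0 throughout.\<close>

lemma mahler_ext_morita_multiples:
  assumes x: "x \<in> padic_ints"
  shows "mahler_ext (\<lambda>n. of_int (morita_multiples CARD('p) n)) x
       = (if vabs x < 1 then padic_Gamma x else 0 :: 'p padic)"
proof -
  let ?G = "mahler_ext (\<lambda>n. of_int (morita CARD('p) n)) :: 'p padic \<Rightarrow> 'p padic"
  let ?M = "mahler_ext (\<lambda>n. of_int (morita_multiples CARD('p) n)) :: 'p padic \<Rightarrow> 'p padic"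
  note u = padic_uniform_morita[OF odd] and u' = padic_uniform_morita_multiples[OF odd]
  obtain s where s: "(\<lambda>n. of_nat (s n) :: 'p padic) \<longlonglongrightarrow> x"
    using padic_int_limit_of_nats[OF x] .
  have M: "(\<lambda>n. ?M (of_nat (s n))) \<longlonglongrightarrow> ?M x"
    by (rule continuous_on_padic_ints_tendsto[OF continuous_on_mahler_ext[OF u'] s x]) simp_all
  have "(\<lambda>n. if vabs x < 1 then ?G (of_nat (s n)) else 0) \<longlonglongrightarrow> (if vabs x < 1 then ?G x else 0)"
    using continuous_on_padic_ints_tendsto[OF continuous_on_mahler_ext[OF u] s x] by simp
  moreover have "\<forall>\<^sub>F n in sequentially. (if vabs x < 1 then ?G (of_nat (s n)) else 0) = ?M (of_nat (s n))"
    using eventually_vabs_less_1_iff[OF s]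
  proof eventually_elim
    case (elim n)
    have "?G (of_nat (s n)) = of_int (morita CARD('p) (s n))"
      by (rule mahler_ext_of_nat[OF u]) simp
    moreover have "?M (of_nat (s n)) = of_int (morita_multiples CARD('p) (s n))"
      by (rule mahler_ext_of_nat[OF u']) simp
    ultimately show ?case
      using elim by (simp add: morita_multiples_def vabs_padic_of_nat_less_1_iff)
  qed
  ultimately have "(\<lambda>n. ?M (of_nat (s n))) \<longlonglongrightarrow> (if vabs x < 1 then ?G x else 0)"
    by (rule Lim_transform_eventually)
  then have "?M x = (if vabs x < 1 then ?G x else 0)"
    by (rule LIMSEQ_unique[OF M])
  then show ?thesis
    using padic_Gamma_eq_mahler_ext[OF x] by simp
qed

end


section \<open>The coefficients of the exponential series\<close>

text \<open>In characteristic 0 the equation A' = A B determines each coefficient from the earlier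
  ones.\<close>

lemma fps_deriv_eq_mult_unique:
  fixes A A' B :: "'a :: field_char_0 fps"
  assumes "fps_deriv A = A * B" and "fps_deriv A' = A' * B" and "A $ 0 = A' $ 0"
  shows "A = A'"
proof (rule fps_ext)
  fix n
  show "fps_nth A n = fps_nth A' n"
  proof (induction n rule: less_induct)
    case (less n)
    show ?case
    proof (cases n)
      case (Suc m)
      have "(A * B) $ m = (A' * B) $ m"
        unfolding fps_mult_nth using less Suc by (intro sum.cong) auto
      then have "of_nat (m + 1) * A $ (m + 1) = of_nat (m + 1) * A' $ (m + 1)"
        unfolding assms(1,2)[symmetric] fps_deriv_nth .
      then show ?thesis
        unfolding Suc by (metis Suc_eq_plus1 mult_cancel_left of_nat_neq_0)
    qed (use assms(3) in simp)
  qed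
qed

lemma prod_mult_fact:
  "(\<Prod>j=Suc k..<Suc k + m. int j) * fact k = fact (k + m)"
proof (induction m)
  case (Suc m)
  have "(\<Prod>j=Suc k..<Suc k + Suc m. int j) = (\<Prod>j=Suc k..<Suc k + m. int j) * int (Suc k + m)"
    unfolding add_Suc_right[of "Suc k"] by (rule prod.atLeastLessThan_Suc) simp
  then have "(\<Prod>j=Suc k..<Suc k + Suc m. int j) * fact k = int (Suc k + m) * fact (k + m)"
    by (simp only: flip: Suc.IH) (simp only: mult_ac)
  then show ?case
    by simp
qed simp

text \<open>Among the factors at k, ..., k + p - 1 only the one at the multiple k is exceptional;
  the others give (k+p-1)!/k! up to sign. For w(k) = (-1)^k \<Gamma>_p(k) this reads w(k+p)/(k+p-1)!
  = w(k)/k!, the coefficient recurrence of exp(X^p/p).\<close>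

lemma morita_add_multiple:
  assumes "p dvd k" and "p > 0"
  shows "fact k * ((- 1) ^ (k + p) * morita p (k + p)) = fact (k + p - 1) * ((- 1) ^ k * morita p k)"
proof -
  have "morita p (k + p) = morita p k * (\<Prod>j=k..<k + p. morita_factor p j)"
    unfolding morita_def using prod.atLeastLessThan_concat[of 0 k "k + p" "morita_factor p"]
    by (simp add: lessThan_atLeast0)
  also have "(\<Prod>j=k..<k + p. morita_factor p j) = - (\<Prod>j=Suc k..<k + p. morita_factor p j)"
    using assms by (simp add: prod.atLeast_Suc_lessThan[of k] morita_factor_def)
  also have "(\<Prod>j=Suc k..<k + p. morita_factor p j) = (\<Prod>j=Suc k..<k + p. - int j)"
  proof (intro prod.cong refl)
    fix j
    assume j: "j \<in> {Suc k..<k + p}"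
    have "\<not> p dvd j"
    proof
      assume "p dvd j"
      then have "p dvd j - k"
        using assms(1) by (rule dvd_diff_nat)
      then show False
        using j by (auto dest: dvd_imp_le)
    qed
    then show "morita_factor p j = - int j"
      by (simp add: morita_factor_def)
  qed
  also have "\<dots> = (- 1) ^ (p - 1) * (\<Prod>j=Suc k..<Suc k + (p - 1). int j)"
    using assms(2) by (simp add: prod_uminus)
  finally have "fact k * ((- 1) ^ (k + p) * morita p (k + p))
      = ((- 1) ^ p * (- ((- 1) ^ (p - 1)))) * ((- 1) ^ k * morita p k)
        * ((\<Prod>j=Suc k..<Suc k + (p - 1). int j) * fact k)"
    by (simp add: power_add mult_ac)
  also have "(- 1) ^ p * (- ((- 1) ^ (p - 1))) = (1 :: int)"
    using assms(2) by (cases p) (simp_all flip: power_add mult_2)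
  finally show ?thesis
    unfolding prod_mult_fact using assms(2) by (simp add: mult_ac)
qed

text \<open>
  The right factor is the series $E$ of $\exp(X^p / p)$, characterised by $E' = X^{p-1} E$.
\<close>

lemma fps_exp_compose_eq:
  fixes p :: nat
  assumes "p > 0"
  shows "fps_exp 1 oo (fps_const (1 / of_nat p) * fps_X ^ p + fps_X)
    = (fps_exp 1 * Abs_fps (\<lambda>k. of_int ((- 1) ^ k * morita_multiples p k) / fact k) :: 'a :: field_char_0 fps)"
proof (rule fps_deriv_eq_mult_unique)
  let ?b = "fps_const (1 / of_nat p) * fps_X ^ p + fps_X :: 'a fps"
  let ?B = "fps_X ^ (p - 1) + 1 :: 'a fps"
  define w where "w k = (- 1) ^ k * morita_multiples p k" for k
  let ?E = "Abs_fps (\<lambda>k. of_int (w k) / fact k) :: 'a fps"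
  have b0: "?b $ 0 = 0"
    using assms by simp
  have "fps_deriv ?b = ?B"
    using assms by (simp add: fps_deriv_power' fps_of_nat[symmetric] mult.assoc[symmetric])
  then show "fps_deriv (fps_exp 1 oo ?b) = (fps_exp 1 oo ?b) * ?B"
    using fps_compose_deriv[OF b0, of "fps_exp 1"] by simp
  \<comment> \<open>Comparison of the coefficients of X^n in E' = X^(p-1) E. Where p does not divide
    n + 1, both sides are 0.\<close>
  have rec: "of_int (w (Suc n)) / fact n = (if n < p - 1 then 0 else of_int (w (n - (p - 1))) / fact (n - (p - 1)) :: 'a)" for n
  proof (cases "n < p - 1")
    case True
    then have "\<not> p dvd Suc n"
      by (auto dest: dvd_imp_le)
    then show ?thesis
      using True by (simp add: w_def morita_multiples_def)
  next
    case False
    define k where "k = n - (p - 1)"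
    have n: "Suc n = k + p" "k + p - 1 = n"
      using False assms by (auto simp: k_def)
    have "fact k * w (k + p) = fact (k + p - 1) * w k"
      using morita_add_multiple[OF _ assms, of k] by (auto simp: w_def morita_multiples_def)
    then have "of_int (fact k * w (Suc n)) = (of_int (fact n * w k) :: 'a)"
      unfolding n by (rule arg_cong)
    then have "fact k * of_int (w (Suc n)) = (fact n * of_int (w k) :: 'a)"
      by simp
    then show ?thesis
      using False unfolding k_def[symmetric] by (simp add: field_simps)
  qed
  have "fps_deriv ?E = fps_X ^ (p - 1) * ?E"
  proof (rule fps_ext)
    fix n
    have "fps_deriv ?E $ n = of_int (w (Suc n)) / fact n"
      by (simp del: of_nat_Suc)
    then show "fps_deriv ?E $ n = (fps_X ^ (p - 1) * ?E) $ n"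
      by (simp add: rec fps_X_power_mult_nth)
  qed
  then have "fps_deriv (fps_exp 1 * ?E) = fps_exp 1 * ?E * ?B"
    by (simp add: algebra_simps)
  then show "fps_deriv (fps_exp 1 * Abs_fps (\<lambda>k. of_int ((- 1) ^ k * morita_multiples p k) / fact k))
      = fps_exp 1 * Abs_fps (\<lambda>k. of_int ((- 1) ^ k * morita_multiples p k) / fact k) * ?B"
    by (simp add: w_def)
qed (simp add: fps_compose_nth_0 morita_multiples_def)

text \<open>After scaling by i!, multiplication by exp(X) is a binomial convolution; the sign (-1)^i
  combines with (-1)^k into the signs of an i-th difference.\<close>

lemma fps_exp_compose_nth:
  fixes p :: nat
  assumes "p > 0"
  defines "f \<equiv> fps_exp 1 oo (fps_const (1 / of_nat p) * fps_X ^ p + fps_X) :: 'a :: field_char_0 fps"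
  shows "(- 1) ^ i * fact i * fps_nth f i = of_int ((fdiff ^^ i) (morita_multiples p) 0)"
proof -
  have "f = Abs_fps (\<lambda>k. of_int ((- 1) ^ k * morita_multiples p k) / fact k) * fps_exp 1"
    unfolding f_def fps_exp_compose_eq[OF assms(1)] by (rule mult.commute)
  then have "fact i * fps_nth f i
      = (\<Sum>k\<le>i. fact i * (of_int ((- 1) ^ k * morita_multiples p k) / fact k * (1 / fact (i - k))))"
    by (simp add: fps_mult_nth sum_distrib_left atLeast0AtMost)
  also have "\<dots> = (\<Sum>k\<le>i. of_nat (i choose k) * of_int ((- 1) ^ k * morita_multiples p k))"
    by (intro sum.cong) (simp_all add: binomial_fact field_simps)
  finally have "fact i * fps_nth f i = (\<Sum>k\<le>i. of_nat (i choose k) * of_int ((- 1) ^ k * morita_multiples p k))" .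
  then show ?thesis
    by (simp add: fdiff_funpow_eq_sum mult.assoc sum_distrib_left)
      (simp add: power_add mult_ac)
qed


section \<open>The Mahler series of the exponential\<close>

lemma complex_padic_of_padic_add:
  "complex_padic_of_padic (x + y) = complex_padic_of_padic x + complex_padic_of_padic y"
  by (simp add: complex_padic_of_padic_def to_vcompletion_add)

lemma complex_padic_of_padic_diff:
  "complex_padic_of_padic (x - y) = complex_padic_of_padic x - complex_padic_of_padic y"
  by (simp add: complex_padic_of_padic_def to_vcompletion_diff)

lemma complex_padic_of_padic_mult:
  "complex_padic_of_padic (x * y) = complex_padic_of_padic x * complex_padic_of_padic y"
  by (simp add: complex_padic_of_padic_def to_vcompletion_mult)

lemma complex_padic_of_padic_0 [simp]: "complex_padic_of_padic 0 = 0"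
  by (simp add: complex_padic_of_padic_def)

lemma complex_padic_of_padic_of_int [simp]: "complex_padic_of_padic (of_int k) = of_int k"
  by (simp add: complex_padic_of_padic_def)

lemma complex_padic_of_padic_sum:
  "complex_padic_of_padic (sum f A) = (\<Sum>i\<in>A. complex_padic_of_padic (f i))"
  by (induction A rule: infinite_finite_induct) (simp_all add: complex_padic_of_padic_add)

text \<open>The embedding is additive and preserves absolute values, hence it preserves limits of
  partial sums.\<close>

lemma sums_complex_padic_of_padic:
  assumes "f sums S"
  shows "(\<lambda>i. complex_padic_of_padic (f i)) sums complex_padic_of_padic S"
  using assms
  by (simp add: sums_def tendsto_vabs_iff flip: complex_padic_of_padic_sum complex_padic_of_padic_diff)

text \<open>Moving i! from the falling factorial to the coefficient leaves an integer times a
  binomial, so every term already lies in Q_p.\<close>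

lemma mahler_term_exp:
  fixes f :: "'p::prime_card complex_padic fps"
  assumes "f = fps_exp 1 oo (fps_const (1 / of_nat CARD('p)) * fps_X ^ CARD('p) + fps_X)"
  shows "mahler_term f x i = complex_padic_of_padic
    ((fdiff ^^ i) (\<lambda>n. of_int (morita_multiples CARD('p) n)) 0 * (x gchoose i))"
proof -
  have "(fdiff ^^ i) (\<lambda>n. of_int (morita_multiples CARD('p) n)) 0
      = (of_int ((fdiff ^^ i) (morita_multiples CARD('p)) 0) :: 'p padic)"
    by (simp add: fdiff_funpow_eq_sum)
  then have "complex_padic_of_padic ((fdiff ^^ i) (\<lambda>n. of_int (morita_multiples CARD('p) n)) 0 * (x gchoose i))
      = (- 1) ^ i * fps_nth f i * (fact i * complex_padic_of_padic (x gchoose i))"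
    using fps_exp_compose_nth[where 'a = "'p complex_padic", of "CARD('p)" i] prime_gt_0_nat[OF prime_card[where 'a = 'p]]
    by (simp add: assms complex_padic_of_padic_mult mult_ac)
  also have "fact i * complex_padic_of_padic (x gchoose i) = complex_padic_of_padic (of_int (fact i) * (x gchoose i))"
    unfolding complex_padic_of_padic_mult complex_padic_of_padic_of_int by simp
  also have "of_int (fact i) * (x gchoose i) = falling_factorial x i"
    by (simp add: gbinomial_eq_falling_factorial)
  finally show ?thesis
    by (simp add: mahler_term_def mult_ac)
qed

text \<open>Summability belongs to the conclusion because \<open>mahler_series\<close> is an
  infinite sum, whose value is meaningful only when the series converges.\<close>

theorem proposition2p6:
  fixes f :: "'p::prime_card complex_padic fps" and x :: "'p padic"
  assumes "odd CARD('p)"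
    and "f = fps_exp 1 oo (fps_const (1 / of_nat CARD('p)) * fps_X ^ CARD('p) + fps_X)"
    and "x \<in> padic_ints"
  shows "summable (mahler_term f x) \<and>
    (vabs x < 1 \<longrightarrow> mahler_series f x = complex_padic_of_padic (padic_Gamma x)) \<and>
    (vabs x = 1 \<longrightarrow> mahler_series f x = 0)"
proof -
  have "(\<lambda>i. (fdiff ^^ i) (\<lambda>n. of_int (morita_multiples CARD('p) n)) 0 * (x gchoose i))
      sums mahler_ext (\<lambda>n. of_int (morita_multiples CARD('p) n)) x"
    using mahler_ext_sums[OF padic_uniform_morita_multiples[OF assms(1)] _ assms(3)] by simp
  then have "mahler_term f x sums complex_padic_of_padic (if vabs x < 1 then padic_Gamma x else 0)"
    unfolding mahler_ext_morita_multiples[OF assms(1,3)] mahler_term_exp[OF assms(2)]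
    by (rule sums_complex_padic_of_padic)
  then show ?thesis
    unfolding mahler_series_def by (auto simp: sums_iff)
qed

end
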